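(* Let $z_0\in\mathbb{C}$ and $0<r_2<r_1$, let $\Omega_2=\{z\in\mathbb{C}:r_2<|z-z_0|<r_1\}$ with boundary $\Gamma_2$, and let $S_2(z,a)$ be the Szegő kernel for $\Omega_2$. Then for all $a\in\Omega_2$ and $z\in\Omega_2\cup\Gamma_2$, $$S_2(z,a)=\frac{1}{2\pi}\sum_{n=-\infty}^{\infty}\frac{(\overline{a}-\overline{z_0})^n}{r_1^{2n+1}+r_2^{2n+1}}(z-z_0)^n$$ and $$S_2(z,a)=\frac{1}{2\pi}\sum_{n=-\infty}^{\infty}\frac{(-1)^n r_1^{n+1}r_2^n}{r_2^{2n}r_1^2-r_1^{2n}(z-z_0)(\overline{a}-\overline{z_0})}.$$ Moreover, for each $a\in\Omega_2$, the zero of $S_2(\cdot,a)$ in $\Omega_2$ is $$z=z_0-\frac{r_1r_2}{\overline{a}-\overline{z_0}}.$$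
   Context: The Szegő kernel $S_2(z,a)$ for $\Omega_2$ is the reproducing kernel of the Hardy space $H^2(\Gamma_2)$, where $\Gamma_2$ consists of the circles $|z-z_0|=r_1$ and $|z-z_0|=r_2$ and the inner product is $\langle f,g\rangle=\int_{\Gamma_2}f\,\overline{g}\,|dz|$ with $|dz|$ arc length measure; equivalently $S_2(z,a)=\sum_n\varphi_n(z)\overline{\varphi_n(a)}$ for any orthonormal basis $\{\varphi_n\}$ of $H^2(\Gamma_2)$. For fixed $a\in\Omega_2$ it is holomorphic in $z\in\Omega_2$ and its values for $z\in\Gamma_2$ are its boundary values. *)

theory Defs
  imports "HOL-Complex_Analysis.Complex_Analysis"
begin

definition annulus :: "complex \<Rightarrow> real \<Rightarrow> real \<Rightarrow> complex set" where
  "annulus z0 r1 r2 = {z. r2 < cmod (z - z0) \<and> cmod (z - z0) < r1}"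

definition annulus_bdry :: "complex \<Rightarrow> real \<Rightarrow> real \<Rightarrow> complex set" where
  "annulus_bdry z0 r1 r2 = sphere z0 r1 \<union> sphere z0 r2"

text \<open>Integration against arc length \<open>|dz|\<close>, using \<open>|dz| = r dt\<close> for the parametrization
  \<open>z = z0 + r exp (i t)\<close> of a circle of radius \<open>r > 0\<close>.\<close>

definition circle_arc_integral :: "complex \<Rightarrow> real \<Rightarrow> (complex \<Rightarrow> complex) \<Rightarrow> complex" where
  "circle_arc_integral z0 r f =
     of_real r * (LINT t|lebesgue_on {0..2*pi}. f (z0 + of_real r * cis t))"

definition circle_L2 :: "complex \<Rightarrow> real \<Rightarrow> (complex \<Rightarrow> complex) set" where
  "circle_L2 z0 r = {f.
     (\<lambda>t. f (z0 + of_real r * cis t)) \<in> borel_measurable (lebesgue_on {0..2*pi}) \<and>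
     integrable (lebesgue_on {0..2*pi}) (\<lambda>t. (cmod (f (z0 + of_real r * cis t)))\<^sup>2)}"

definition bdry_inner ::
  "complex \<Rightarrow> real \<Rightarrow> real \<Rightarrow> (complex \<Rightarrow> complex) \<Rightarrow> (complex \<Rightarrow> complex) \<Rightarrow> complex" where
  "bdry_inner z0 r1 r2 f g =
     circle_arc_integral z0 r1 (\<lambda>z. f z * cnj (g z)) +
     circle_arc_integral z0 r2 (\<lambda>z. f z * cnj (g z))"

text \<open>The Hardy space is the closure, in \<open>L\<^sup>2\<close> of the boundary, of the boundary values of
  functions continuous on the closed annulus and holomorphic inside. An element is represented
  by a function carrying both its boundary values (up to null sets) and its holomorphic
  extension to the annulus; since point evaluations are continuous in the \<open>L\<^sup>2\<close> norm
  (by the Cauchy integral formula), the extension is the pointwise limit of the approximants.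
  Values off the closed annulus are irrelevant.\<close>

definition annulus_algebra :: "complex \<Rightarrow> real \<Rightarrow> real \<Rightarrow> (complex \<Rightarrow> complex) set" where
  "annulus_algebra z0 r1 r2 = {f. f holomorphic_on annulus z0 r1 r2 \<and>
     continuous_on (annulus z0 r1 r2 \<union> annulus_bdry z0 r1 r2) f}"

definition hardy_space :: "complex \<Rightarrow> real \<Rightarrow> real \<Rightarrow> (complex \<Rightarrow> complex) set" where
  "hardy_space z0 r1 r2 = {f.
     f holomorphic_on annulus z0 r1 r2 \<and> f \<in> circle_L2 z0 r1 \<inter> circle_L2 z0 r2 \<and>
     (\<exists>F :: nat \<Rightarrow> complex \<Rightarrow> complex.
        (\<forall>n. F n \<in> annulus_algebra z0 r1 r2) \<and>
        (\<lambda>n. bdry_inner z0 r1 r2 (\<lambda>z. F n z - f z) (\<lambda>z. F n z - f z)) \<longlonglongrightarrow> 0 \<and>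
        (\<forall>z\<in>annulus z0 r1 r2. (\<lambda>n. F n z) \<longlonglongrightarrow> f z))}"

text \<open>\<open>k\<close> represents evaluation at \<open>a\<close>. Continuity up to the boundary makes the values of
  \<open>k\<close> on the boundary circles its boundary values pointwise, not only almost everywhere, and
  so pins \<open>k\<close> down on the whole closed annulus.\<close>

definition is_szego_at ::
  "complex \<Rightarrow> real \<Rightarrow> real \<Rightarrow> complex \<Rightarrow> (complex \<Rightarrow> complex) \<Rightarrow> bool" where
  "is_szego_at z0 r1 r2 a k \<longleftrightarrow>
     k \<in> hardy_space z0 r1 r2 \<and>
     continuous_on (annulus z0 r1 r2 \<union> annulus_bdry z0 r1 r2) k \<and>
     (\<forall>f\<in>hardy_space z0 r1 r2. f a = bdry_inner z0 r1 r2 f k)"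

definition szego_kernel ::
  "complex \<Rightarrow> real \<Rightarrow> real \<Rightarrow> complex \<Rightarrow> complex \<Rightarrow> complex" where
  "szego_kernel z0 r1 r2 z a = (SOME k. is_szego_at z0 r1 r2 a k) z"

end

theory Submission
  imports Defs
begin

text \<open>
  Write \<open>\<alpha> = a - z0\<close>, \<open>q = r2 / r1\<close>, \<open>p = q\<^sup>2\<close> and let \<open>u\<close> be \<open>z - z0\<close> times the conjugate of \<open>\<alpha>\<close>,
  divided by \<open>r1\<^sup>2\<close>; for \<open>a\<close> in the annulus and \<open>z\<close> in its closure one has \<open>p < |u| < 1\<close>.

  The powers of \<open>z - z0\<close> are orthogonal on the boundary, so the first series is what the
  expansion of the kernel in an orthonormal basis predicts. That it does reproduce values is checked
  directly. For functions continuous on the closed annulus and holomorphic inside, Cauchy's theorem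
  (\<open>circle_mean_const\<close>) shows that the Laurent coefficients can be computed on either boundary
  circle and that the Laurent series represents the function inside (\<open>annulus_algebra_laurent\<close>);
  integrating the kernel termwise then gives the value at \<open>a\<close> (\<open>bdry_inner_szego_algebra\<close>). An \<open>L\<^sup>2\<close>
  limit extends this to the Hardy space (\<open>bdry_inner_szego_hardy\<close>), and a reproducing kernel is
  unique (\<open>is_szego_at_unique\<close>).

  Up to the factor \<open>1 / (2 \<pi> r1)\<close> the first series is Kronecker's function
  \<open>K(u, b) = \<Sum>\<^sub>n u\<^sup>n / (1 - b p\<^sup>n)\<close> at \<open>b = - q\<close>. Expanding the denominators geometrically shows
  that \<open>K(u, b) = K(b, u)\<close>, and this symmetry is the equality of the two series of the theorem. The same
  expansion gives \<open>K(u, p / u) = 0\<close>, hence the zero \<open>u = - q\<close>.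

  That there is no other zero (\<open>kronecker_theta_zero\<close>) is usually read off from a theta quotient. Here
  it follows from a partial fraction identity: if \<open>K(x, b) = K(x, c) = 0\<close> and \<open>b / c\<close> is not a power
  of \<open>p\<close>, then \<open>K(u, b) K(x / u, c) = 0\<close> for \<open>|x| < |u| < 1\<close> (\<open>kronecker_product_eq_0\<close>). A zero
  \<open>x\<close> other than \<open>- q\<close> would allow \<open>b = - q\<close> and \<open>c = p / x\<close>, whereas neither factor vanishes
  identically.
\<close>

section \<open>Kronecker's bilateral series\<close>

lemma bilateral_has_sum:
  fixes f :: "int \<Rightarrow> 'a :: {topological_ab_group_add, uniform_topological_group_add, ab_group_add}"
  assumes "((\<lambda>n::nat. f (int n)) has_sum s) UNIV"
    and "((\<lambda>n::nat. f (- 1 - int n)) has_sum t) UNIV"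
  shows "(f has_sum (s + t)) UNIV"
proof -
  have 1: "(f has_sum s) {0..}"
  proof -
    have "((\<lambda>n::nat. f (int n)) has_sum s) UNIV \<longleftrightarrow> (f has_sum s) {0..}"
      by (rule has_sum_reindex_bij_witness[of _ nat int]) auto
    then show ?thesis using assms by simp
  qed
  have 2: "(f has_sum t) {..<0}"
  proof -
    have "((\<lambda>n::nat. f (- 1 - int n)) has_sum t) UNIV \<longleftrightarrow> (f has_sum t) {..<0}"
      by (rule has_sum_reindex_bij_witness[of _ "\<lambda>n. nat (-1-n)" "\<lambda>n. -1 - int n"]) auto
    then show ?thesis using assms by simp
  qed
  have "(f has_sum (s + t)) ({0..} \<union> {..<0})"
    by (rule has_sum_Un_disjoint[OF 1 2]) auto
  moreover have "{0..} \<union> {..<0} = (UNIV :: int set)" by auto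
  ultimately show ?thesis by simp
qed

text \<open>The absolutely convergent double series to which every bilateral series below is reduced. It is
  visibly symmetric in \<open>x\<close> and \<open>y\<close>, and summing out one of the two indices gives the series of
  \<open>lambert_rows\<close>.\<close>

definition lambert :: "real \<Rightarrow> complex \<Rightarrow> complex \<Rightarrow> complex" where
  "lambert p x y = (\<Sum>\<^sub>\<infinity>(n,k)\<in>UNIV. x ^ n * y ^ k * of_real p ^ (n * k))"

lemma has_sum_geometric:
  fixes z :: "'a :: {real_normed_field, banach}"
  assumes "norm z < 1"
  shows "((\<lambda>n. z ^ n) has_sum (1 / (1 - z))) UNIV"
  using assms
  by (intro norm_summable_imp_has_sum geometric_sums) (auto simp: norm_power intro: summable_geometric)

lemma lambert_summable:
  assumes p: "0 < p" "p < 1" and "cmod x < 1" "cmod y < 1"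
  shows "(\<lambda>(n,k). x ^ n * y ^ k * of_real p ^ (n * k)) summable_on UNIV"
proof -
  have "(\<lambda>(n,k). cmod x ^ n * cmod y ^ k) summable_on (UNIV \<times> UNIV)"
  proof (rule summable_on_SigmaI)
    show "((\<lambda>k. case (n,k) of (n,k) \<Rightarrow> cmod x ^ n * cmod y ^ k) has_sum (cmod x ^ n * (1 / (1 - cmod y)))) UNIV" for n
      using has_sum_cmult_right[OF has_sum_geometric[of "cmod y"], of "cmod x ^ n"] assms by simp
    show "(\<lambda>n. cmod x ^ n * (1 / (1 - cmod y))) summable_on UNIV"
      using has_sum_cmult_left[OF has_sum_geometric[of "cmod x"], of "1 / (1 - cmod y)"] assms
      unfolding summable_on_def by auto
  qed auto
  then have "(\<lambda>z. norm (case z of (n,k) \<Rightarrow> x ^ n * y ^ k * of_real p ^ (n * k))) summable_on (UNIV \<times> UNIV)"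
  proof (rule Infinite_Sum.abs_summable_on_comparison_test')
    have "norm (x ^ n * y ^ k * of_real p ^ (n * k)) \<le> cmod x ^ n * cmod y ^ k" for n k
      using p by (auto simp: norm_mult norm_power intro!: mult_left_le power_le_one)
    then show "\<And>z. norm (case z of (n,k) \<Rightarrow> x ^ n * y ^ k * of_real p ^ (n * k))
        \<le> (case z of (n,k) \<Rightarrow> cmod x ^ n * cmod y ^ k)" by auto
  qed
  from abs_summable_summable[OF this] show ?thesis by simp
qed

lemma lambert_has_sum:
  assumes "0 < p" "p < 1" "cmod x < 1" "cmod y < 1"
  shows "((\<lambda>(n,k). x ^ n * y ^ k * of_real p ^ (n * k)) has_sum lambert p x y) (UNIV \<times> UNIV)"
  using lambert_summable[OF assms] unfolding lambert_def by simp

lemma lambert_commute: "lambert p x y = lambert p y x"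
  unfolding lambert_def
  by (rule infsum_reindex_bij_witness[of _ prod.swap prod.swap]) (auto simp: mult_ac)

lemma lambert_rows:
  assumes p: "0 < p" "p < 1" and "cmod x < 1" "cmod y < 1"
  shows "((\<lambda>n. x ^ n / (1 - y * of_real p ^ n)) has_sum lambert p x y) UNIV"
proof (rule has_sum_SigmaD[OF lambert_has_sum[OF assms]])
  fix n
  have "cmod y * p ^ n < 1"
    by (smt (verit) assms mult_left_le norm_ge_zero power_le_one)
  then have *: "cmod (y * of_real p ^ n) < 1"
    using p by (simp add: norm_mult norm_power)
  show "((\<lambda>k. case (n, k) of (n,k) \<Rightarrow> x ^ n * y ^ k * of_real p ^ (n * k))
      has_sum (x ^ n / (1 - y * of_real p ^ n))) UNIV"
    using has_sum_cmult_right[OF has_sum_geometric[OF *], of "x ^ n"]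
    by (simp add: power_mult_distrib power_mult mult_ac)
qed

text \<open>Kronecker's function \<open>\<Sum>\<^sub>n u\<^sup>n / (1 - b p\<^sup>n)\<close>, the sum over all integers \<open>n\<close>, for
  \<open>p < |u|, |b| < 1\<close>. The terms with negative \<open>n\<close> have been rewritten so that they are again a
  \<open>lambert\<close> series; in this form the symmetry in \<open>u\<close> and \<open>b\<close> is immediate.\<close>

definition kronecker :: "real \<Rightarrow> complex \<Rightarrow> complex \<Rightarrow> complex" where
  "kronecker p u b = lambert p u b - of_real p / (u * b) * lambert p (of_real p / u) (of_real p / b)"

lemma kronecker_commute: "kronecker p u b = kronecker p b u"
  unfolding kronecker_def by (simp add: lambert_commute[of p u] lambert_commute[of p "of_real p / u"] mult.commute)

text \<open>At \<open>b = p / u\<close> the map \<open>(u, b) \<mapsto> (p / u, p / b)\<close> merely exchanges the two arguments, so the two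
  halves of the series cancel.\<close>

lemma kronecker_eq_0:
  assumes "0 < p" "u \<noteq> 0"
  shows "kronecker p u (of_real p / u) = 0"
  unfolding kronecker_def using assms by (simp add: lambert_commute[of p u])

lemma kronecker_denom_nonzero:
  assumes p: "0 < p" "p < 1" and b: "p < cmod b" "cmod b < 1"
  shows "1 - b * of_real p powi n \<noteq> 0"
proof
  assume "1 - b * of_real p powi n = 0"
  then have "cmod b * p powi n = 1"
    using p by (metis eq_iff_diff_eq_0 norm_mult norm_of_real norm_one norm_power_int abs_of_pos)
  moreover have "cmod b * p powi n < 1" if "n \<ge> 0"
  proof -
    have "p powi n \<le> 1" using that p by (simp add: power_int_def power_le_one)
    then show ?thesis using b p by (smt (verit) mult_left_le norm_ge_zero)
  qed
  moreover have "cmod b * p powi n > 1" if "n < 0"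
  proof -
    have "p powi n = p powi (n+1) / p" using p by (simp add: power_int_add)
    moreover have "p powi (n+1) \<ge> 1"
      using that p by (auto simp: power_int_def one_le_inverse_iff power_le_one field_simps)
    ultimately have "p powi n \<ge> 1 / p" using p by (simp add: divide_right_mono)
    then have "cmod b * p powi n \<ge> cmod b * (1/p)" by (intro mult_left_mono) auto
    moreover have "cmod b * (1/p) > 1" using b p by simp
    ultimately show ?thesis by linarith
  qed
  ultimately show False by (cases "n \<ge> 0") auto
qed

text \<open>For \<open>n = - 1 - m\<close> the factor \<open>p\<^sup>m\<^sup>+\<^sup>1\<close> is moved into the numerator, which turns the negative
  half into minus \<open>p / (u b)\<close> times the \<open>lambert\<close> series at \<open>(p / u, p / b)\<close>.\<close>

lemma kronecker_has_sum:
  assumes p: "0 < p" "p < 1" and u: "p < cmod u" "cmod u < 1" and b: "p < cmod b" "cmod b < 1"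
  shows "((\<lambda>n::int. u powi n / (1 - b * of_real p powi n)) has_sum kronecker p u b) UNIV"
proof -
  have nz: "u \<noteq> 0" "b \<noteq> 0" using u b p by auto
  let ?P = "of_real p :: complex"
  have "((\<lambda>n::nat. u powi (- 1 - int n) / (1 - b * ?P powi (- 1 - int n)))
      has_sum (- (?P / (u * b)) * lambert p (?P / u) (?P / b))) UNIV"
  proof -
    have "((\<lambda>n::nat. - (?P / (u * b)) * ((?P / u) ^ n / (1 - ?P / b * ?P ^ n)))
      has_sum (- (?P / (u * b)) * lambert p (?P / u) (?P / b))) UNIV"
      by (intro has_sum_cmult_right lambert_rows)
        (use p u b nz in \<open>auto simp: norm_divide divide_simps\<close>)
    moreover have "- (?P / (u * b)) * ((?P / u) ^ n / (1 - ?P / b * ?P ^ n))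
       = u powi (- 1 - int n) / (1 - b * ?P powi (- 1 - int n))" for n
    proof -
      have e: "- 1 - int n = - int (Suc n)" by simp
      have "1 - b * ?P powi (- 1 - int n) \<noteq> 0"
        using kronecker_denom_nonzero[OF p b] .
      then have 1: "b - ?P ^ Suc n \<noteq> 0"
        using p unfolding e power_int_minus power_int_of_nat by (auto simp: field_simps)
      show ?thesis using 1 nz p unfolding e power_int_minus power_int_of_nat
        by (auto simp: divide_simps power_divide) (auto simp: algebra_simps)
    qed
    ultimately show ?thesis by simp
  qed
  moreover have "((\<lambda>n::nat. u powi int n / (1 - b * ?P powi int n)) has_sum lambert p u b) UNIV"
    using lambert_rows[OF p u(2) b(2)] by simp
  ultimately have "((\<lambda>n::int. u powi n / (1 - b * of_real p powi n)) has_sum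
       (lambert p u b + - (?P / (u * b)) * lambert p (?P / u) (?P / b))) UNIV"
    by (intro bilateral_has_sum) auto
  then show ?thesis by (simp add: kronecker_def)
qed

text \<open>All terms of the series are positive here.\<close>

lemma kronecker_pos_nonzero:
  assumes p: "0 < p" "p < 1" and u: "p < u" "u < 1" and b: "p < b" "b < 1"
  shows "kronecker p (of_real u) (- of_real b) \<noteq> 0"
proof
  assume "kronecker p (of_real u) (- of_real b) = 0"
  then have "((\<lambda>n::int. complex_of_real u powi n / (1 - (- of_real b) * of_real p powi n)) has_sum 0) UNIV"
    using kronecker_has_sum[OF p, of "of_real u" "- of_real b"] u b p by simp
  also have "(\<lambda>n::int. complex_of_real u powi n / (1 - (- of_real b) * of_real p powi n)) =
     (\<lambda>n. of_real (u powi n / (1 + b * p powi n)))" by (simp add: of_real_power_int)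
  finally have "((\<lambda>n::int. u powi n / (1 + b * p powi n)) has_sum 0) UNIV"
    by (metis has_sum_of_real_iff of_real_0)
  then have "u powi 0 / (1 + b * p powi 0) = 0"
    by (rule nonneg_has_sum_le_0D) (use u b p in \<open>auto simp: add_nonneg_nonneg\<close>)
  with b p show False by auto
qed

lemma abs_summable_mult:
  fixes f :: "'a \<Rightarrow> complex" and g :: "'b \<Rightarrow> complex"
  assumes "f summable_on A" "g summable_on B"
  shows "(\<lambda>(x,y). f x * g y) summable_on (A \<times> B)"
proof -
  have f: "(\<lambda>x. cmod (f x)) summable_on A" and g: "(\<lambda>x. cmod (g x)) summable_on B"
    using assms by (simp_all add: summable_on_iff_abs_summable_on_complex)
  have "(\<lambda>(x,y). cmod (f x) * cmod (g y)) summable_on (A \<times> B)"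
  proof (rule summable_on_SigmaI)
    show "((\<lambda>y. case (x,y) of (x,y) \<Rightarrow> cmod (f x) * cmod (g y)) has_sum
       (cmod (f x) * infsum (\<lambda>y. cmod (g y)) B)) B" for x
      using has_sum_cmult_right[OF has_sum_infsum[OF g]] by simp
    show "(\<lambda>x. cmod (f x) * infsum (\<lambda>y. cmod (g y)) B) summable_on A"
      by (intro summable_on_cmult_left f)
  qed auto
  then have "(\<lambda>z. norm (case z of (x,y) \<Rightarrow> f x * g y)) summable_on (A \<times> B)"
    by (simp add: case_prod_unfold norm_mult)
  then show ?thesis by (rule abs_summable_summable)
qed

text \<open>A degenerate case of the addition theorem (Fay's identity) for Kronecker's function. With
  \<open>A\<^sub>n = 1 / (1 - b p\<^sup>n)\<close>, \<open>C\<^sub>m = 1 / (1 - c p\<^sup>m)\<close> and \<open>v = x / u\<close>, the product of the two series is the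
  double sum of \<open>u\<^sup>n v\<^sup>m A\<^sub>n C\<^sub>m\<close>. On the diagonal \<open>m = n + k\<close> the power is \<open>x\<^sup>n v\<^sup>k\<close>, and partial
  fractions write \<open>A\<^sub>n C\<^sub>n\<^sub>+\<^sub>k\<close> as a combination of \<open>A\<^sub>n\<close> and \<open>C\<^sub>n\<^sub>+\<^sub>k\<close> with coefficients that do not
  depend on \<open>n\<close>. Summing over \<open>n\<close>, each diagonal is therefore a combination of the two vanishing
  series at \<open>x\<close>. The hypothesis on \<open>b\<close> and \<open>c\<close> keeps the partial fractions finite.\<close>

lemma kronecker_product_eq_0:
  assumes p: "0 < p" "p < 1" and x: "p < cmod x" "cmod x < cmod u" "cmod u < 1"
    and b: "p < cmod b" "cmod b < 1" and c: "p < cmod c" "cmod c < 1"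
    and bc: "\<And>k::int. c * of_real p powi k \<noteq> b"
    and zero: "kronecker p x b = 0" "kronecker p x c = 0"
  shows "kronecker p u b * kronecker p (x / u) c = 0"
proof -
  let ?P = "of_real p :: complex"
  define v where "v = x / u"
  define A where "A n = 1 / (1 - b * ?P powi n)" for n :: int
  define C where "C n = 1 / (1 - c * ?P powi n)" for n :: int
  have nz: "x \<noteq> 0" "u \<noteq> 0" "b \<noteq> 0" "c \<noteq> 0" "v \<noteq> 0" using x p b c by (auto simp: v_def)
  have uv: "u * v = x" using nz by (simp add: v_def)
  have v: "p < cmod v" "cmod v < 1"
  proof -
    have "p * cmod u < p" using p x by simp
    with x have "p * cmod u < cmod x" by linarith
    then show "p < cmod v" using nz by (simp add: v_def norm_divide pos_less_divide_eq)
    show "cmod v < 1" using nz x by (simp add: v_def norm_divide)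
  qed
  have sA: "((\<lambda>n. w powi n * A n) has_sum kronecker p w b) UNIV" if "p < cmod w" "cmod w < 1" for w
    using kronecker_has_sum[OF p that b] by (simp add: A_def)
  have sC: "((\<lambda>n. w powi n * C n) has_sum kronecker p w c) UNIV" if "p < cmod w" "cmod w < 1" for w
    using kronecker_has_sum[OF p that c] by (simp add: C_def)
  have u: "p < cmod u" "cmod x < 1" using x by auto
  note su = sA[OF u(1) x(3)] and sv = sC[OF v]
  have sxA: "((\<lambda>n. x powi n * A n) has_sum 0) UNIV"
    using sA[OF x(1) u(2)] zero by simp
  have sxC: "((\<lambda>n. x powi n * C n) has_sum 0) UNIV"
    using sC[OF x(1) u(2)] zero by simp
  define f where "f = (\<lambda>(n,m). (u powi n * A n) * (v powi m * C m))"
  have fs: "(f has_sum (kronecker p u b * kronecker p v c)) (UNIV \<times> UNIV)"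
  proof (rule has_sum_SigmaI)
    show "((\<lambda>m. f (n, m)) has_sum (u powi n * A n * kronecker p v c)) UNIV" for n
      unfolding f_def using has_sum_cmult_right[OF sv] by simp
    show "((\<lambda>n. u powi n * A n * kronecker p v c) has_sum (kronecker p u b * kronecker p v c)) UNIV"
      by (rule has_sum_cmult_left[OF su])
    show "f summable_on UNIV \<times> UNIV"
      unfolding f_def by (rule abs_summable_mult[OF has_sum_imp_summable[OF su] has_sum_imp_summable[OF sv]])
  qed
  have fs': "((\<lambda>(k,n). f (n, n + k)) has_sum (kronecker p u b * kronecker p v c)) (UNIV \<times> UNIV)"
    using fs by (subst has_sum_reindex_bij_witness[of _ "\<lambda>(n,m). (m - n, n)" "\<lambda>(k,n). (n, n + k)"]) auto
  have row: "((\<lambda>n. f (n, n + k)) has_sum 0) UNIV" for k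
  proof -
    define r where "r = c / b * ?P powi k"
    have r1: "r \<noteq> 1" using bc[of k] nz by (auto simp: r_def field_simps)
    have r0: "r \<noteq> 0" using nz p by (auto simp: r_def)
    have "((\<lambda>n. x powi (n + k) * C (n + k)) has_sum 0) UNIV"
      using sxC by (subst has_sum_reindex_bij_witness[of _ "\<lambda>n. n - k" "\<lambda>n. n + k"]) auto
    from has_sum_cmult_right[OF this, of "u powi (-k) / (1 - 1/r)"]
    have 1: "((\<lambda>n. u powi (-k) / (1 - 1/r) * (x powi (n + k) * C (n + k))) has_sum 0) UNIV" by simp
    from has_sum_cmult_right[OF sxA, of "v powi k / (1 - r)"]
    have 2: "((\<lambda>n. v powi k / (1 - r) * (x powi n * A n)) has_sum 0) UNIV" by simp
    have "f (n, n + k) = v powi k / (1 - r) * (x powi n * A n)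
             + u powi (-k) / (1 - 1/r) * (x powi (n + k) * C (n + k))" for n
    proof -
      define X where "X = b * ?P powi n"
      have Y: "c * ?P powi (n + k) = r * X"
        using nz p by (simp add: X_def r_def power_int_add)
      have d1: "1 - X \<noteq> 0" unfolding X_def by (rule kronecker_denom_nonzero[OF p b])
      have d2: "1 - r * X \<noteq> 0" unfolding Y[symmetric] by (rule kronecker_denom_nonzero[OF p c])
      \<comment> \<open>The partial fraction decomposition; its coefficients depend on \<open>k\<close> only.\<close>
      have e1: "1 / (1 - X) * (1 / (1 - r * X)) =
          1 / (1 - r) * (1 / (1 - X)) + 1 / (1 - 1/r) * (1 / (1 - r * X))"
      proof -
        have "1 / (1 - 1/r) = - r / (1 - r)"
          using r1 r0 by (simp add: divide_simps) (simp add: algebra_simps)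
        moreover have "1 / (1 - X) * (1 / (1 - r * X)) =
            1 / (1 - r) * (1 / (1 - X)) + - r / (1 - r) * (1 / (1 - r * X))"
          using d1 d2 r1 by (simp add: divide_simps) (simp add: algebra_simps)
        ultimately show ?thesis by (simp only:)
      qed
      have e2: "u powi n * v powi (n + k) = x powi n * v powi k"
        using nz by (simp add: power_int_add uv[symmetric] power_int_mult_distrib)
      have e3: "u powi (-k) * x powi (n + k) = x powi n * v powi k"
        using nz by (simp add: v_def power_int_add power_int_divide_distrib power_int_minus divide_simps)
      have "f (n, n + k) = (u powi n * v powi (n + k)) * (A n * C (n + k))" by (simp add: f_def)
      also have "A n * C (n + k) = 1 / (1 - r) * A n + 1 / (1 - 1/r) * C (n + k)"
        unfolding A_def C_def Y X_def[symmetric] by (rule e1)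
      also have "(u powi n * v powi (n + k)) * (1 / (1 - r) * A n + 1 / (1 - 1/r) * C (n + k))
          = v powi k / (1 - r) * (x powi n * A n) + (u powi (-k) * x powi (n + k)) / (1 - 1/r) * C (n + k)"
        unfolding e2 e3 by (simp add: algebra_simps add_divide_distrib)
      finally show ?thesis by simp
    qed
    with has_sum_add[OF 2 1] show ?thesis by simp
  qed
  have "((\<lambda>k::int. 0::complex) has_sum (kronecker p u b * kronecker p v c)) UNIV"
    by (rule has_sum_SigmaD[OF fs']) (use row in auto)
  then show ?thesis
    using has_sum_0_simp has_sum_unique unfolding v_def by blast
qed

section \<open>Laurent series on closed annuli\<close>

text \<open>On \<open>r \<le> |z| \<le> R\<close> the modulus of \<open>z\<^sup>n\<close> is at most \<open>R\<^sup>n + r\<^sup>n\<close>, whatever the sign of \<open>n\<close>, so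
  absolute convergence at the two radii gives a summable majorant.\<close>

lemma laurent_uniform_limit:
  fixes c :: "int \<Rightarrow> complex"
  assumes r: "0 < r" "r \<le> R"
    and R_sum: "(\<lambda>n. c n * of_real R powi n) summable_on UNIV"
    and r_sum: "(\<lambda>n. c n * of_real r powi n) summable_on UNIV"
  shows "uniform_limit {z. r \<le> cmod z \<and> cmod z \<le> R} (\<lambda>X z. \<Sum>n\<in>X. c n * z powi n)
           (\<lambda>z. \<Sum>\<^sub>\<infinity>n. c n * z powi n) (finite_subsets_at_top UNIV)"
proof (rule Weierstrass_m_test_general)
  show "(\<lambda>n. cmod (c n * of_real R powi n) + cmod (c n * of_real r powi n)) summable_on UNIV"
    using R_sum r_sum by (intro summable_on_add) (simp_all flip: summable_on_iff_abs_summable_on_complex)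
  fix n :: int and z :: complex
  assume z: "z \<in> {z. r \<le> cmod z \<and> cmod z \<le> R}"
  have "cmod z powi n \<le> R powi n + r powi n"
  proof (cases "n \<ge> 0")
    case True
    then have "cmod z powi n \<le> R powi n" using z r by (auto simp: power_int_def power_mono)
    moreover have "0 \<le> r powi n" using r by simp
    ultimately show ?thesis by linarith
  next
    case False
    then have "cmod z powi n \<le> r powi n"
      using z r by (auto simp: power_int_def intro!: power_mono le_imp_inverse_le)
    moreover have "0 \<le> R powi n" using r by simp
    ultimately show ?thesis by linarith
  qed
  then have "cmod (c n) * cmod z powi n \<le> cmod (c n) * (R powi n + r powi n)"
    by (rule mult_left_mono) simp
  then show "norm (c n * z powi n) \<le> cmod (c n * of_real R powi n) + cmod (c n * of_real r powi n)"
    using r by (simp add: norm_mult norm_power_int distrib_left)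
qed

lemma laurent_continuous_on:
  fixes c :: "int \<Rightarrow> complex"
  assumes "0 < r" "r \<le> R"
    and "(\<lambda>n. c n * of_real R powi n) summable_on UNIV"
    and "(\<lambda>n. c n * of_real r powi n) summable_on UNIV"
  shows "continuous_on {z. r \<le> cmod z \<and> cmod z \<le> R} (\<lambda>z. \<Sum>\<^sub>\<infinity>n. c n * z powi n)"
proof (rule uniform_limit_theorem[OF _ laurent_uniform_limit[OF assms]])
  show "\<forall>\<^sub>F X in finite_subsets_at_top UNIV.
     continuous_on {z. r \<le> cmod z \<and> cmod z \<le> R} (\<lambda>z. \<Sum>n\<in>X. c n * z powi n)"
    using assms(1) by (intro always_eventually allI continuous_intros) auto
qed auto

lemma open_annulus: "open (annulus z0 r1 r2)"
  unfolding annulus_def by (intro open_Collect_conj open_Collect_less continuous_intros)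

lemma laurent_holomorphic_on:
  fixes c :: "int \<Rightarrow> complex"
  assumes r: "0 < r" "r \<le> R"
    and "(\<lambda>n. c n * of_real R powi n) summable_on UNIV"
    and "(\<lambda>n. c n * of_real r powi n) summable_on UNIV"
  shows "(\<lambda>z. \<Sum>\<^sub>\<infinity>n. c n * z powi n) holomorphic_on annulus 0 R r"
proof -
  let ?f = "\<lambda>z. \<Sum>\<^sub>\<infinity>n. c n * z powi n"
  have "\<exists>e>0. ?f holomorphic_on ball w e" if "w \<in> annulus 0 R r" for w
  proof -
    obtain e where e: "e > 0" "cball w e \<subseteq> annulus 0 R r"
      using open_annulus \<open>w \<in> _\<close> open_contains_cball by blast
    have sub: "cball w e \<subseteq> {z. r \<le> cmod z \<and> cmod z \<le> R}" and nz: "\<forall>z\<in>cball w e. z \<noteq> 0"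
      using e r by (fastforce simp: annulus_def)+
    have ev: "\<forall>\<^sub>F X in finite_subsets_at_top UNIV. continuous_on (cball w e) (\<lambda>z. \<Sum>n\<in>X. c n * z powi n)
            \<and> (\<lambda>z. \<Sum>n\<in>X. c n * z powi n) holomorphic_on ball w e"
    proof (intro always_eventually allI conjI)
      fix X
      show "continuous_on (cball w e) (\<lambda>z. \<Sum>n\<in>X. c n * z powi n)"
        using nz by (intro continuous_intros) auto
      show "(\<lambda>z. \<Sum>n\<in>X. c n * z powi n) holomorphic_on ball w e"
        using nz ball_subset_cball[of w e] by (intro holomorphic_intros) blast
    qed
    show ?thesis
      by (rule holomorphic_uniform_limit[OF ev uniform_limit_on_subset[OF laurent_uniform_limit[OF assms]]])
        (use e sub in auto)
  qed
  then show ?thesis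
    by (meson holomorphic_on_imp_differentiable_at holomorphic_on_open open_annulus
        field_differentiable_def holomorphic_on_def centre_in_ball field_differentiable_at_within open_ball)
qed

text \<open>Termwise integration. The phases \<open>e n\<close> are left abstract because the series is used with powers of
  \<open>cis t\<close> of either sign and with index sets \<open>nat\<close> and \<open>int\<close>.\<close>

lemma integral_series:
  fixes c :: "'a \<Rightarrow> complex" and g :: "real \<Rightarrow> complex"
  assumes c: "c summable_on UNIV"
    and e: "\<And>n. continuous_on {a..b} (e n)" "\<And>n t. t \<in> {a..b} \<Longrightarrow> cmod (e n t) \<le> 1"
    and g: "continuous_on {a..b} g"
  shows "((\<lambda>n. c n * integral {a..b} (\<lambda>t. g t * e n t))
           has_sum integral {a..b} (\<lambda>t. g t * (\<Sum>\<^sub>\<infinity>n. c n * e n t))) UNIV"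
proof -
  obtain B where B: "B \<ge> 0" "\<And>t. t \<in> {a..b} \<Longrightarrow> cmod (g t) \<le> B"
    using compact_continuous_image[OF g] compact_imp_bounded[of "g ` {a..b}"]
    unfolding bounded_iff by (meson compact_Icc image_eqI norm_ge_zero order_trans
      bounded_iff[of "g ` {a..b}"] linorder_linear)
  have u: "uniform_limit {a..b} (\<lambda>X t. \<Sum>n\<in>X. g t * (c n * e n t)) (\<lambda>t. \<Sum>\<^sub>\<infinity>n. g t * (c n * e n t))
      (finite_subsets_at_top UNIV)"
  proof (rule Weierstrass_m_test_general)
    show "(\<lambda>n. B * cmod (c n)) summable_on UNIV"
      using c by (intro summable_on_cmult_right) (simp flip: summable_on_iff_abs_summable_on_complex)
    fix n t assume t: "t \<in> {a..b}"
    have "cmod (g t) * (cmod (c n) * cmod (e n t)) \<le> B * (cmod (c n) * 1)"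
      using B e t by (intro mult_mono) auto
    then show "norm (g t * (c n * e n t)) \<le> B * cmod (c n)" by (simp add: norm_mult)
  qed
  obtain I J where I: "\<And>X. ((\<lambda>t. \<Sum>n\<in>X. g t * (c n * e n t)) has_integral I X) {a..b}"
    and J: "((\<lambda>t. \<Sum>\<^sub>\<infinity>n. g t * (c n * e n t)) has_integral J) {a..b}"
    and lim: "(I \<longlongrightarrow> J) (finite_subsets_at_top UNIV)"
    by (rule uniform_limit_integral[OF u]) (use e g in \<open>auto intro!: continuous_intros\<close>)
  have "I X = (\<Sum>n\<in>X. c n * integral {a..b} (\<lambda>t. g t * e n t))" for X
  proof -
    have ii: "(\<lambda>t. g t * e n t) integrable_on {a..b}" for n
      using e g by (intro integrable_continuous_interval continuous_intros) auto
    have "I X = integral {a..b} (\<lambda>t. \<Sum>n\<in>X. c n * (g t * e n t))"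
      using I[of X] by (simp add: integral_unique mult_ac)
    also have "\<dots> = (\<Sum>n\<in>X. c n * integral {a..b} (\<lambda>t. g t * e n t))"
    proof (cases "finite X")
      case True
      then show ?thesis
        using ii by (subst integral_sum) (auto intro!: integrable_on_mult_right)
    qed simp
    finally show ?thesis .
  qed
  moreover have "J = integral {a..b} (\<lambda>t. g t * (\<Sum>\<^sub>\<infinity>n. c n * e n t))"
    using J by (simp add: infsum_cmult_right' integral_unique)
  ultimately have "(sum (\<lambda>n. c n * integral {a..b} (\<lambda>t. g t * e n t))
      \<longlongrightarrow> integral {a..b} (\<lambda>t. g t * (\<Sum>\<^sub>\<infinity>n. c n * e n t))) (finite_subsets_at_top UNIV)"
    using lim by presburger
  then show ?thesis unfolding has_sum_def .
qed

lemma integral_cis: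
  fixes n :: int
  shows "integral {0..2*pi} (\<lambda>t. cis (of_int n * t)) = (if n = 0 then 2 * of_real pi else 0)"
proof (cases "n = 0")
  case False
  have "((\<lambda>t. cis (of_int n * t)) has_integral
      (cis (of_int n * (2*pi)) / (\<i> * of_int n) - cis (of_int n * 0) / (\<i> * of_int n))) {0..2*pi}"
  proof (rule fundamental_theorem_of_calculus)
    fix t :: real
    have "((\<lambda>z. exp (\<i> * of_int n * z) / (\<i> * of_int n)) has_field_derivative
        exp (\<i> * of_int n * of_real t)) (at (of_real t))"
      using False by (auto intro!: derivative_eq_intros)
    from has_vector_derivative_real_field[OF this]
    show "((\<lambda>t. cis (of_int n * t) / (\<i> * of_int n)) has_vector_derivative cis (of_int n * t))
        (at t within {0..2*pi})"
      by (simp add: cis_conv_exp mult.assoc)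
  qed simp
  moreover have "cis (of_int n * (2*pi)) = 1"
    by (metis cis_multiple_2pi Ints_of_int mult.commute)
  ultimately show ?thesis using False by (simp add: integral_unique)
qed (simp add: scaleR_conv_of_real)

lemma laurent_constant_coeff:
  fixes c :: "int \<Rightarrow> complex"
  assumes "0 < \<rho>" and sum: "(\<lambda>n. c n * of_real \<rho> powi n) summable_on UNIV"
  shows "integral {0..2*pi} (\<lambda>t. \<Sum>\<^sub>\<infinity>n. c n * (of_real \<rho> * cis t) powi n) = 2 * of_real pi * c 0"
proof -
  have cis_powi: "(of_real \<rho> * cis t) powi n = of_real \<rho> powi n * cis (of_int n * t)" for n t
    by (simp add: power_int_mult_distrib cis_power_int)
  have "((\<lambda>n. c n * of_real \<rho> powi n * integral {0..2*pi} (\<lambda>t. 1 * cis (of_int n * t)))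
           has_sum integral {0..2*pi} (\<lambda>t. 1 * (\<Sum>\<^sub>\<infinity>n. c n * of_real \<rho> powi n * cis (of_int n * t)))) UNIV"
    by (rule integral_series[OF sum]) (auto intro!: continuous_intros)
  moreover have "c n * of_real \<rho> powi n * integral {0..2*pi} (\<lambda>t. 1 * cis (of_int n * t))
      = (if n = 0 then c 0 * (of_real pi * 2) else 0)" for n
    unfolding mult_1 integral_cis by simp
  ultimately have "((\<lambda>n::int. if n = 0 then c 0 * (of_real pi * 2) else 0)
           has_sum integral {0..2*pi} (\<lambda>t. (\<Sum>\<^sub>\<infinity>n. c n * (of_real \<rho> * cis t) powi n))) UNIV"
    unfolding cis_powi mult.assoc by simp
  moreover have "((\<lambda>n::int. if n = 0 then c 0 * (of_real pi * 2) else 0) has_sum (2 * of_real pi * c 0)) UNIV"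
    by (rule has_sum_finite_neutralI[of "{0}"]) auto
  ultimately show ?thesis by (rule has_sum_unique)
qed

section \<open>The zeros of Kronecker's series\<close>

lemma square_bounds:
  fixes q :: real
  assumes "0 < q" "q < 1"
  shows "0 < q\<^sup>2" "q\<^sup>2 < 1" "q\<^sup>2 < q"
proof -
  show "0 < q\<^sup>2" "q\<^sup>2 < q" using assms by (simp_all add: power2_eq_square)
  then show "q\<^sup>2 < 1" using assms by simp
qed

text \<open>That \<open>- q\<close> is a zero is the cancellation in \<open>kronecker_eq_0\<close>, since \<open>- q = q\<^sup>2 / (- q)\<close>. For the
  converse let \<open>x\<close> be another zero. Then both \<open>b = - q\<close> and \<open>c = q\<^sup>2 / x\<close> give a Kronecker
  series vanishing at \<open>x\<close>, and they do not differ by a power of \<open>q\<^sup>2\<close> unless \<open>x = - q\<close>. By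
  \<open>kronecker_product_eq_0\<close> the product of the series for \<open>b\<close> at \<open>u\<close> and of the series for \<open>c\<close> at
  \<open>x / u\<close> is zero for \<open>|x| < |u| < 1\<close>. The first factor is positive for real positive \<open>u\<close>, hence
  the second vanishes on a radial segment, hence identically; but its constant Laurent coefficient
  \<open>1 / (1 - c)\<close> is not zero.\<close>

lemma kronecker_theta_zero:
  assumes q: "0 < q" "q < 1" and x: "q\<^sup>2 < cmod x" "cmod x < 1"
  shows "kronecker (q\<^sup>2) x (- of_real q) = 0 \<longleftrightarrow> x = - of_real q"
proof
  assume "x = - of_real q"
  then show "kronecker (q\<^sup>2) x (- of_real q) = 0"
    using kronecker_eq_0[of "q\<^sup>2" x] q by (simp add: power2_eq_square)
next
  assume zero: "kronecker (q\<^sup>2) x (- of_real q) = 0"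
  show "x = - of_real q"
  proof (rule ccontr)
    assume neq: "x \<noteq> - of_real q"
    define p where "p = q\<^sup>2"
    have p: "0 < p" "p < 1" and qp: "p < q" using square_bounds[OF q] by (simp_all add: p_def)
    define b c where "b = - complex_of_real q" and "c = of_real p / x"
    have xnz: "x \<noteq> 0" "0 < cmod x" using x by (auto intro: le_less_trans[of 0 "q^2"])
    note x = x[folded p_def]
    have b: "p < cmod b" "cmod b < 1" using q qp by (auto simp: b_def)
    have c: "p < cmod c" "cmod c < 1"
      using p x xnz by (auto simp: c_def norm_divide divide_simps)
    have z: "kronecker p x b = 0" "kronecker p x c = 0"
      using zero kronecker_eq_0[of p x] p xnz by (auto simp: p_def b_def c_def)
    \<comment> \<open>Comparing moduli, such a \<open>k\<close> would place \<open>q\<^sup>2\<^sup>k\<^sup>+\<^sup>2\<close> strictly between \<open>q\<^sup>3\<close> and \<open>q\<close>.\<close>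
    have bc: "c * of_real p powi k \<noteq> b" for k :: int
    proof
      assume "c * of_real p powi k = b"
      then have e: "of_real p powi (k + 1) = - of_real q * x"
        using xnz p by (simp add: c_def b_def power_int_add field_simps)
      then have n: "p powi (k + 1) = q * cmod x"
        using p q by (metis norm_mult norm_of_real norm_power_int abs_of_pos norm_minus_cancel)
      have "q powi 1 > q powi (2 * (k+1))" "q powi (2 * (k+1)) > q powi 3"
      proof -
        have e2: "q powi (2 * (k+1)) = q * cmod x"
          unfolding n[symmetric] p_def using power_int_mult[of q 2 "k + 1"] by simp
        show "q powi 1 > q powi (2 * (k+1))" unfolding e2 using q x by simp
        show "q powi (2 * (k+1)) > q powi 3" unfolding e2
          using q x by (simp add: p_def power3_eq_cube power2_eq_square)
      qed
      then have "1 < 2 * (k+1)" "2 * (k+1) < 3"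
        using q by (metis power_int_decreasing less_le_not_le linorder_not_less)+
      then have "k = 0" by presburger
      with e have "of_real q * (x + of_real q) = 0"
        by (simp add: p_def power2_eq_square algebra_simps)
      with neq q show False by (auto simp: eq_neg_iff_add_eq_0)
    qed
    define R where "R = (1 + cmod x) / 2"
    have R: "cmod x < R" "R < 1" using x by (auto simp: R_def)
    have prod0: "kronecker p u b * kronecker p (x / u) c = 0" if "cmod x < cmod u" "cmod u < 1" for u
      by (rule kronecker_product_eq_0[OF p x(1) that b c bc z])
    define C where "C n = 1 / (1 - c * of_real p powi n)" for n :: int
    define G where "G v = (\<Sum>\<^sub>\<infinity>n. C n * v powi n)" for v
    have Cs: "((\<lambda>n. C n * v powi n) has_sum kronecker p v c) UNIV" if "p < cmod v" "cmod v < 1" for v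
      using kronecker_has_sum[OF p that c] by (simp add: C_def)
    then have G: "G v = kronecker p v c" if "p < cmod v" "cmod v < 1" for v
      unfolding G_def using that infsumI by blast
    have sumC: "(\<lambda>n. C n * of_real s powi n) summable_on UNIV" if "p < s" "s < 1" for s
      by (rule has_sum_imp_summable[OF Cs]) (use that p in auto)
    have hol: "G holomorphic_on annulus 0 R (cmod x)"
      unfolding G_def
      by (rule laurent_holomorphic_on) (use xnz R x in \<open>auto intro!: sumC\<close>)
    define d where "d = x / of_real (cmod x)"
    have d: "cmod d = 1" using xnz by (simp add: d_def norm_divide)
    have ray: "G (of_real s * d) = 0" if "cmod x < s" "s < 1" for s
    proof -
      have s0: "s > 0" using that xnz by linarith
      define t where "t = cmod x / s"
      have "cmod x * s < cmod x * 1" using that xnz by (intro mult_strict_left_mono) auto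
      then have t: "cmod x < t" "t < 1"
        using that s0 by (simp_all add: t_def pos_less_divide_eq pos_divide_less_eq)
      have "kronecker p (of_real t) b \<noteq> 0"
        unfolding b_def by (rule kronecker_pos_nonzero[OF p]) (use t x q qp in auto)
      moreover have "x / of_real t = of_real s * d"
        using s0 xnz by (simp add: t_def d_def)
      ultimately have "kronecker p (of_real s * d) c = 0"
        using prod0[of "of_real t"] t xnz by auto
      then show ?thesis
        using that x s0 d by (subst G) (auto simp: norm_mult)
    qed
    \<comment> \<open>A set of zeros of \<open>G\<close> with an accumulation point \<open>s0 d\<close> inside its domain.\<close>
    define U where "U = (\<lambda>s. of_real s * d) ` {cmod x<..<R}"
    define s0 where "s0 = (cmod x + R) / 2"
    have s0: "cmod x < s0" "s0 < R" using R by (auto simp: s0_def)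
    have G0: "G w = 0" if "w \<in> annulus 0 R (cmod x)" for w
    proof (rule analytic_continuation[OF hol open_annulus])
      show "connected (annulus 0 R (cmod x))"
        unfolding annulus_def using connected_annulus(1)[of "cmod x" "0::complex" R] by simp
      show "U \<subseteq> annulus 0 R (cmod x)"
        using less_trans[OF xnz(2)] d by (auto simp: U_def annulus_def norm_mult abs_of_pos)
      show "of_real s0 * d \<in> annulus 0 R (cmod x)"
        using less_trans[OF xnz(2) s0(1)] d s0 by (simp add: annulus_def norm_mult)
      show "of_real s0 * d islimpt U"
        unfolding islimpt_approachable
      proof (intro allI impI)
        fix e :: real assume "e > 0"
        define s where "s = s0 + min (e/2) ((R - s0)/2)"
        have s: "s0 < s" "s < R" "s - s0 < e"
          using \<open>e > 0\<close> s0 by (auto simp: s_def min_def field_simps)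
        have "of_real s * d - of_real s0 * d = of_real (s - s0) * d" by (simp add: algebra_simps)
        then have "dist (of_real s * d) (of_real s0 * d) = s - s0"
          using s d by (simp add: dist_norm norm_mult del: of_real_diff)
        with s s0 show "\<exists>y\<in>U. y \<noteq> of_real s0 * d \<and> dist y (of_real s0 * d) < e"
          by (intro bexI[of _ "of_real s * d"]) (auto simp: U_def)
      qed
      show "G z = 0" if "z \<in> U" for z
        using that ray R by (auto simp: U_def)
    qed (use that in auto)
    have "integral {0..2*pi} (\<lambda>t. G (of_real s0 * cis t)) = 2 * of_real pi * C 0"
      unfolding G_def by (rule laurent_constant_coeff) (use s0 less_trans[OF xnz(2) s0(1)] x R in \<open>auto intro!: sumC\<close>)
    moreover have "(\<lambda>t. G (of_real s0 * cis t)) = (\<lambda>t. 0)"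
      using less_trans[OF xnz(2) s0(1)] s0 by (auto intro!: G0 simp: annulus_def norm_mult)
    ultimately have "C 0 = 0" by simp
    then show False using c by (auto simp: C_def)
  qed
qed

section \<open>Laurent expansion on the closed annulus\<close>

abbreviation (input) closed_annulus :: "complex \<Rightarrow> real \<Rightarrow> real \<Rightarrow> complex set" where
  "closed_annulus z0 r1 r2 \<equiv> annulus z0 r1 r2 \<union> annulus_bdry z0 r1 r2"

lemma closed_annulus_eq:
  assumes "r2 < r1"
  shows "closed_annulus z0 r1 r2 = {z. r2 \<le> cmod (z - z0) \<and> cmod (z - z0) \<le> r1}"
  using assms by (auto simp: annulus_def annulus_bdry_def dist_norm norm_minus_commute)

lemma closed_annulus_polar:
  assumes "0 < r2" "r2 < r1" "\<rho> = r1 \<or> \<rho> = r2"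
  shows "z0 + of_real \<rho> * cis t \<in> closed_annulus z0 r1 r2"
  using assms by (auto simp: closed_annulus_eq norm_mult)

lemma continuous_on_circle:
  assumes "0 < r2" "r2 < r1" "\<rho> = r1 \<or> \<rho> = r2" "continuous_on (closed_annulus z0 r1 r2) f"
  shows "continuous_on T (\<lambda>t. f (z0 + of_real \<rho> * cis t))"
  by (rule continuous_on_compose2[OF assms(4)])
    (use closed_annulus_polar[OF assms(1-3)] in \<open>auto intro!: continuous_intros\<close>)

text \<open>Cauchy's theorem for the closed annulus, with continuity only at the boundary. In the
  coordinate \<open>z = z0 + exp w\<close> the annulus becomes a convex strip, on which the pulled back function
  \<open>E\<close> has a primitive \<open>P\<close> up to the boundary. As \<open>E\<close> has period \<open>2 \<pi> \<i>\<close>, the increment of \<open>P\<close>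
  over one period is constant on the strip, and up to the factor \<open>\<i>\<close> it is the mean over a circle.\<close>

lemma circle_mean_const:
  assumes r: "0 < r2" "r2 < r1" and G: "G \<in> annulus_algebra z0 r1 r2"
  shows "integral {0..2*pi} (\<lambda>t. G (z0 + of_real r1 * cis t)) =
         integral {0..2*pi} (\<lambda>t. G (z0 + of_real r2 * cis t))"
proof -
  have hol: "G holomorphic_on annulus z0 r1 r2" and cont: "continuous_on (closed_annulus z0 r1 r2) G"
    using G by (auto simp: annulus_algebra_def)
  define S where "S = {w. ln r2 \<le> Re w \<and> Re w \<le> ln r1}"
  define E where "E w = G (z0 + exp w)" for w
  have r1: "0 < r1" using r by simp
  have convex: "convex S"
    unfolding S_def using convex_Int[OF convex_halfspace_Re_ge[of "ln r2"] convex_halfspace_Re_le[of "ln r1"]]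
    by (simp add: Int_def)
  have exp_bounds: "r2 \<le> exp x \<longleftrightarrow> ln r2 \<le> x" "exp x \<le> r1 \<longleftrightarrow> x \<le> ln r1"
    "r2 < exp x \<longleftrightarrow> ln r2 < x" "exp x < r1 \<longleftrightarrow> x < ln r1" for x
    using r r1 by (metis exp_le_cancel_iff exp_less_cancel_iff exp_ln)+
  have contE: "continuous_on S E"
    unfolding E_def
    by (rule continuous_on_compose2[OF cont])
      (use r in \<open>auto intro!: continuous_intros simp: closed_annulus_eq S_def exp_bounds\<close>)
  have "interior S \<subseteq> {w. ln r2 < Re w \<and> Re w < ln r1}"
  proof -
    have "interior S = interior {w. ln r2 \<le> Re w} \<inter> interior {w. Re w \<le> ln r1}"
      unfolding S_def by (metis Collect_conj_eq interior_Int)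
    then show ?thesis
      using interior_halfspace_ge[of "1::complex" "ln r2"] interior_halfspace_le[of "1::complex" "ln r1"]
      by auto
  qed
  then have diffE: "E field_differentiable at w" if "w \<in> interior S - {}" for w
  proof -
    have "z0 + exp w \<in> annulus z0 r1 r2"
      using that \<open>interior S \<subseteq> _\<close> by (auto simp: annulus_def exp_bounds)
    then have "G field_differentiable at (z0 + exp w)"
      using hol open_annulus holomorphic_on_imp_differentiable_at by blast
    moreover have "(\<lambda>w. z0 + exp w) field_differentiable at w"
      by (intro derivative_intros) (auto intro: field_differentiable_within_exp)
    ultimately show ?thesis
      unfolding E_def using field_differentiable_compose[of "\<lambda>w. z0 + exp w" w G] by (simp add: o_def)
  qed
  obtain P where P: "\<And>w. w \<in> S \<Longrightarrow> (P has_field_derivative E w) (at w within S)"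
    using holomorphic_convex_primitive[OF convex finite.emptyI contE diffE] by blast
  define s where "s w = w + 2 * of_real pi * \<i>" for w :: complex
  have s_S: "s ` S \<subseteq> S" by (auto simp: s_def S_def)
  have Es: "E (s w) = E w" for w by (simp add: E_def s_def exp_add)
  have "((\<lambda>w. P (s w) - P w) has_field_derivative 0) (at w within S)" if "w \<in> S" for w
  proof -
    have "(P has_field_derivative E w) (at (s w) within s ` S)"
      using P[of "s w"] s_S that by (metis Es has_field_derivative_subset image_subset_iff)
    then have "((P \<circ> s) has_field_derivative E w * 1) (at w within S)"
      by (rule DERIV_image_chain) (auto simp: s_def[abs_def] intro!: derivative_eq_intros)
    from DERIV_diff[OF this P[OF that]] show ?thesis by simp
  qed
  then obtain k where k: "\<And>w. w \<in> S \<Longrightarrow> P (s w) - P w = k"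
    using has_field_derivative_zero_constant[OF convex, of "\<lambda>w. P (s w) - P w"] by blast
  have mean: "integral {0..2*pi} (\<lambda>t. G (z0 + of_real \<rho> * cis t)) = k / \<i>"
    if \<rho>: "\<rho> = r1 \<or> \<rho> = r2" for \<rho>
  proof -
    have \<rho>0: "0 < \<rho>" "r2 \<le> \<rho>" "\<rho> \<le> r1" using \<rho> r by auto
    define w where "w t = of_real (ln \<rho>) + \<i> * of_real t" for t :: real
    have wS: "w t \<in> S" for t using \<rho>0 r by (auto simp: w_def S_def)
    have Ew: "E (w t) = G (z0 + of_real \<rho> * cis t)" for t
    proof -
      have "exp (complex_of_real (ln \<rho>)) = of_real \<rho>"
        using \<rho>0 r by (metis exp_of_real exp_ln less_le_trans)
      then show ?thesis by (simp add: E_def w_def exp_add cis_conv_exp)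
    qed
    have "((\<lambda>t. P (w t)) has_vector_derivative \<i> * E (w t)) (at t within {0..2*pi})" for t
    proof -
      have "(w has_vector_derivative \<i>) (at t within {0..2*pi})"
        unfolding w_def[abs_def] has_vector_derivative_def
        by (auto intro!: derivative_eq_intros simp: scaleR_conv_of_real)
      moreover have "(P has_field_derivative E (w t)) (at (w t) within w ` {0..2*pi})"
        using P[OF wS] wS by (meson has_field_derivative_subset image_subset_iff)
      ultimately show ?thesis
        using field_vector_diff_chain_within[of w \<i> t "{0..2*pi}" P] by (simp add: o_def)
    qed
    then have "((\<lambda>t. \<i> * E (w t)) has_integral P (w (2*pi)) - P (w 0)) {0..2*pi}"
      by (intro fundamental_theorem_of_calculus) auto
    moreover have "w (2*pi) = s (w 0)" by (simp add: w_def s_def)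
    ultimately have "((\<lambda>t. \<i> * E (w t)) has_integral k) {0..2*pi}" using k wS by simp
    from has_integral_divide[OF this, of \<i>] show ?thesis by (simp add: Ew integral_unique)
  qed
  from mean[of r1] mean[of r2] show ?thesis by simp
qed

text \<open>\<open>2 \<pi>\<close> times the \<open>n\<close>-th Laurent coefficient of \<open>F\<close> about \<open>z0\<close>, computed on the circle of radius
  \<open>\<rho>\<close>.\<close>

definition circle_moment :: "complex \<Rightarrow> real \<Rightarrow> (complex \<Rightarrow> complex) \<Rightarrow> int \<Rightarrow> complex" where
  "circle_moment z0 \<rho> F n = integral {0..2*pi} (\<lambda>t. F (z0 + of_real \<rho> * cis t) * (of_real \<rho> * cis t) powi (- n))"

lemma circle_moment_eq:
  "circle_moment z0 \<rho> F n = of_real \<rho> powi (- n) *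
     integral {0..2*pi} (\<lambda>t. F (z0 + of_real \<rho> * cis t) * cis (- of_int n * t))"
  unfolding circle_moment_def integral_mult_right[symmetric]
  by (rule integral_cong) (simp add: power_int_mult_distrib cis_power_int mult_ac)

lemma circle_moment_const:
  assumes r: "0 < r2" "r2 < r1" and F: "F \<in> annulus_algebra z0 r1 r2"
  shows "circle_moment z0 r1 F n = circle_moment z0 r2 F n"
proof -
  have "(\<lambda>z. F z * (z - z0) powi (- n)) \<in> annulus_algebra z0 r1 r2"
    using F r unfolding annulus_algebra_def closed_annulus_eq[OF r(2)]
    by (auto intro!: holomorphic_intros continuous_intros simp: annulus_def)
  from circle_mean_const[OF r this] show ?thesis by (simp add: circle_moment_def)
qed

lemma circle_moment_1: "0 < \<rho> \<Longrightarrow> circle_moment z0 \<rho> (\<lambda>z. 1) n = (if n = 0 then 2 * of_real pi else 0)"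
  using integral_cis[of "- n"] by (simp add: circle_moment_eq)

text \<open>The Cauchy kernel \<open>\<zeta> / (\<zeta> - \<alpha>)\<close>, where \<open>\<alpha> = a - z0\<close>, is expanded in a geometric series in \<open>\<alpha> / \<zeta>\<close> on the outer
  circle, which gives the terms \<open>n \<ge> 0\<close>, and in \<open>\<zeta> / \<alpha>\<close> on the inner circle, which gives the terms
  \<open>n < 0\<close> up to sign.\<close>

lemma moment_series:
  assumes r: "0 < r2" "r2 < r1" and F: "F \<in> annulus_algebra z0 r1 r2" and a: "a \<in> annulus z0 r1 r2"
  shows "((\<lambda>n. (a - z0) powi n * circle_moment z0 r1 F n) has_sum
     (integral {0..2*pi} (\<lambda>t. F (z0 + of_real r1 * cis t) * (of_real r1 * cis t / (of_real r1 * cis t - (a - z0)))) -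
      integral {0..2*pi} (\<lambda>t. F (z0 + of_real r2 * cis t) * (of_real r2 * cis t / (of_real r2 * cis t - (a - z0)))))) UNIV"
proof -
  define \<alpha> where "\<alpha> = a - z0"
  have \<alpha>: "r2 < cmod \<alpha>" "cmod \<alpha> < r1" "\<alpha> \<noteq> 0" using a r by (auto simp: \<alpha>_def annulus_def)
  have cont: "continuous_on (closed_annulus z0 r1 r2) F" using F by (simp add: annulus_algebra_def)
  have r1: "0 < r1" using r by simp
  let ?K = "\<lambda>\<rho> t. of_real \<rho> * cis t / (of_real \<rho> * cis t - \<alpha>)"
  let ?I = "\<lambda>\<rho>. integral {0..2*pi} (\<lambda>t. F (z0 + of_real \<rho> * cis t) * ?K \<rho> t)"
  have ne: "of_real \<rho> * cis t - \<alpha> \<noteq> 0" if "\<rho> = r1 \<or> \<rho> = r2" for \<rho> t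
  proof
    assume "of_real \<rho> * cis t - \<alpha> = 0"
    then have "cmod (of_real \<rho> * cis t) = cmod \<alpha>" by simp
    then show False using \<alpha> r that by (auto simp: norm_mult)
  qed
  have outer: "((\<lambda>n::nat. \<alpha> powi int n * circle_moment z0 r1 F (int n)) has_sum ?I r1) UNIV"
  proof -
    define c e where "c n = (\<alpha> / of_real r1) ^ n" and "e n t = cis (- of_int (int n) * t)" for n :: nat and t
    have lt: "cmod (\<alpha> / of_real r1) < 1" using \<alpha> r1 by (simp add: norm_divide)
    have c: "c summable_on UNIV" unfolding c_def by (rule has_sum_imp_summable[OF has_sum_geometric[OF lt]])
    have "(\<Sum>\<^sub>\<infinity>n. c n * e n t) = ?K r1 t" for t
    proof -
      have z: "c n * e n t = (\<alpha> / (of_real r1 * cis t)) ^ n" for n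
      proof -
        have "e n t = inverse (cis t) ^ n" by (simp add: e_def cis_inverse Complex.DeMoivre)
        then have "c n * e n t = (\<alpha> / of_real r1 * inverse (cis t)) ^ n"
          by (simp only: c_def power_mult_distrib)
        then show ?thesis by (simp only: divide_inverse inverse_mult_distrib mult.assoc)
      qed
      have "((\<lambda>n. (\<alpha> / (of_real r1 * cis t)) ^ n) has_sum (1 / (1 - \<alpha> / (of_real r1 * cis t)))) UNIV"
        by (rule has_sum_geometric) (use lt in \<open>simp add: norm_divide norm_mult\<close>)
      moreover have "1 / (1 - \<alpha> / (of_real r1 * cis t)) = ?K r1 t"
      proof -
        have "of_real r1 * cis t \<noteq> (0::complex)" using r1 by simp
        moreover have "of_real r1 * cis t - \<alpha> \<noteq> 0" using ne by blast
        ultimately show ?thesis by (simp add: divide_simps)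
      qed
      ultimately show ?thesis unfolding z using infsumI by simp
    qed
    moreover have "((\<lambda>n. c n * integral {0..2*pi} (\<lambda>t. F (z0 + of_real r1 * cis t) * e n t)) has_sum
       integral {0..2*pi} (\<lambda>t. F (z0 + of_real r1 * cis t) * (\<Sum>\<^sub>\<infinity>n. c n * e n t))) UNIV"
      by (rule integral_series[OF c]) (auto simp: e_def intro!: continuous_intros continuous_on_circle[OF r _ cont])
    moreover have "c n * integral {0..2*pi} (\<lambda>t. F (z0 + of_real r1 * cis t) * e n t)
        = \<alpha> powi int n * circle_moment z0 r1 F (int n)" for n
    proof -
      have "c n = \<alpha> powi int n * of_real r1 powi (- int n)"
        unfolding c_def power_divide power_int_minus power_int_of_nat by (rule divide_inverse)
      then show ?thesis unfolding circle_moment_eq e_def by (simp only: mult.assoc of_int_minus)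
    qed
    ultimately show ?thesis by simp
  qed
  have inner: "((\<lambda>n::nat. \<alpha> powi (- 1 - int n) * circle_moment z0 r1 F (- 1 - int n)) has_sum - ?I r2) UNIV"
  proof -
    define c e where "c n = (of_real r2 / \<alpha>) ^ Suc n" and "e n t = cis (of_int (int (Suc n)) * t)" for n :: nat and t
    have lt: "cmod (of_real r2 / \<alpha>) < 1" using \<alpha> r by (simp add: norm_divide)
    have c: "c summable_on UNIV" unfolding c_def power_Suc
      by (intro summable_on_cmult_right has_sum_imp_summable[OF has_sum_geometric[OF lt]])
    have "(\<Sum>\<^sub>\<infinity>n. c n * e n t) = - ?K r2 t" for t
    proof -
      define y where "y = of_real r2 * cis t / \<alpha>"
      have y: "cmod y < 1" using lt by (simp add: y_def norm_divide norm_mult)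
      have z: "c n * e n t = y * y ^ n" for n
      proof -
        have "e n t = cis t ^ Suc n" by (simp only: e_def of_int_of_nat_eq Complex.DeMoivre)
        then have "c n * e n t = (of_real r2 / \<alpha> * cis t) ^ Suc n"
          by (simp only: c_def power_mult_distrib)
        then show ?thesis by (simp add: y_def)
      qed
      have "((\<lambda>n. y * y ^ n) has_sum (y * (1 / (1 - y)))) UNIV"
        by (intro has_sum_cmult_right has_sum_geometric y)
      moreover have "y * (1 / (1 - y)) = - ?K r2 t"
      proof -
        have "of_real r2 * cis t - \<alpha> \<noteq> 0" using ne by blast
        moreover from this have "\<alpha> - of_real r2 * cis t \<noteq> 0" by auto
        ultimately show ?thesis using \<alpha> by (simp add: y_def divide_simps) (simp add: algebra_simps)
      qed
      ultimately show ?thesis unfolding z using infsumI by simp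
    qed
    moreover have "((\<lambda>n. c n * integral {0..2*pi} (\<lambda>t. F (z0 + of_real r2 * cis t) * e n t)) has_sum
       integral {0..2*pi} (\<lambda>t. F (z0 + of_real r2 * cis t) * (\<Sum>\<^sub>\<infinity>n. c n * e n t))) UNIV"
      by (rule integral_series[OF c]) (auto simp: e_def intro!: continuous_intros continuous_on_circle[OF r _ cont])
    moreover have "c n * integral {0..2*pi} (\<lambda>t. F (z0 + of_real r2 * cis t) * e n t)
        = \<alpha> powi (- 1 - int n) * circle_moment z0 r1 F (- 1 - int n)" for n
    proof -
      have 1: "- (- 1 - int n) = int (Suc n)" and 2: "- 1 - int n = - int (Suc n)" by simp_all
      have 3: "- of_int (- 1 - int n) * t = of_int (int (Suc n)) * t" for t :: real by simp
      have "\<alpha> powi (- 1 - int n) = inverse (\<alpha> ^ Suc n)"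
        unfolding 2 power_int_minus power_int_of_nat ..
      then have "c n = \<alpha> powi (- 1 - int n) * of_real r2 ^ Suc n"
        unfolding c_def power_divide by (simp only: divide_inverse mult.commute)
      then show ?thesis
        unfolding circle_moment_const[OF r F] unfolding circle_moment_eq 1 3 power_int_of_nat e_def
        by (simp only: mult.assoc)
    qed
    ultimately show ?thesis by simp
  qed
  from bilateral_has_sum[OF outer inner] show ?thesis by (simp add: \<alpha>_def)
qed

text \<open>Laurent expansion at an interior point of a function continuous up to the boundary. The means of
  \<open>(F(z) - F(a)) \<zeta> / (\<zeta> - \<alpha>)\<close>, with \<open>\<zeta> = z - z0\<close> and \<open>\<alpha> = a - z0\<close>, agree on both circles, as its
  singularity at \<open>a\<close> is removable. So the difference of the two integrals
  in \<open>moment_series\<close> is \<open>F(a)\<close> times its value for the constant function \<open>1\<close>, and that value is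
  \<open>2 \<pi>\<close> because only the moment with index zero of a constant is nonzero.\<close>

lemma annulus_algebra_laurent:
  assumes r: "0 < r2" "r2 < r1" and F: "F \<in> annulus_algebra z0 r1 r2" and a: "a \<in> annulus z0 r1 r2"
  shows "((\<lambda>n. (a - z0) powi n * circle_moment z0 r1 F n) has_sum 2 * of_real pi * F a) UNIV"
proof -
  let ?K = "\<lambda>\<rho> t. of_real \<rho> * cis t / (of_real \<rho> * cis t - (a - z0))"
  let ?I = "\<lambda>F \<rho>. integral {0..2*pi} (\<lambda>t. F (z0 + of_real \<rho> * cis t) * ?K \<rho> t)"
  have hol: "F holomorphic_on annulus z0 r1 r2" and cont: "continuous_on (closed_annulus z0 r1 r2) F"
    using F by (auto simp: annulus_algebra_def)
  have one: "(\<lambda>z. 1) \<in> annulus_algebra z0 r1 r2" by (simp add: annulus_algebra_def)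
  have "((\<lambda>n::int. (a - z0) powi n * circle_moment z0 r1 (\<lambda>z. 1) n) has_sum (2 * of_real pi)) UNIV"
    using r by (intro has_sum_finite_neutralI[of "{0}"]) (auto simp: circle_moment_1)
  from has_sum_unique[OF moment_series[OF r one a] this]
  have I1: "?I (\<lambda>z. 1) r1 - ?I (\<lambda>z. 1) r2 = 2 * of_real pi" .
  define h where "h z = (if z = a then deriv F a else (F z - F a) / (z - a))" for z
  have holh: "h holomorphic_on annulus z0 r1 r2"
    unfolding h_def by (rule pole_lemma[OF hol]) (simp add: interior_open open_annulus a)
  have conth: "continuous_on (closed_annulus z0 r1 r2) h"
  proof -
    let ?T = "closed_annulus z0 r1 r2 - {a}"
    have eq: "closed_annulus z0 r1 r2 = annulus z0 r1 r2 \<union> ?T" using a by auto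
    have "continuous_on ?T h"
    proof (rule continuous_on_cong[THEN iffD2])
      show "h z = (F z - F a) / (z - a)" if "z \<in> ?T" for z using that by (simp add: h_def)
      show "continuous_on ?T (\<lambda>z. (F z - F a) / (z - a))"
        by (intro continuous_intros continuous_on_subset[OF cont]) auto
    qed auto
    moreover have "openin (top_of_set (annulus z0 r1 r2 \<union> ?T)) (annulus z0 r1 r2)"
      by (rule open_subset) (auto simp: open_annulus)
    moreover have "openin (top_of_set (annulus z0 r1 r2 \<union> ?T)) ?T"
      unfolding eq[symmetric] by (simp add: openin_delete)
    ultimately show ?thesis
      using holomorphic_on_imp_continuous_on[OF holh] by (subst eq) (rule continuous_on_Un_local_open)
  qed
  have "(\<lambda>z. h z * (z - z0)) \<in> annulus_algebra z0 r1 r2"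
    using holh conth unfolding annulus_algebra_def by (auto intro!: holomorphic_intros continuous_intros)
  from circle_mean_const[OF r this]
  have eq: "integral {0..2*pi} (\<lambda>t. h (z0 + of_real r1 * cis t) * (of_real r1 * cis t)) =
        integral {0..2*pi} (\<lambda>t. h (z0 + of_real r2 * cis t) * (of_real r2 * cis t))" by simp
  have "integral {0..2*pi} (\<lambda>t. h (z0 + of_real \<rho> * cis t) * (of_real \<rho> * cis t)) =
      ?I F \<rho> - F a * ?I (\<lambda>z. 1) \<rho>" if \<rho>: "\<rho> = r1 \<or> \<rho> = r2" for \<rho>
  proof -
    have ne: "of_real \<rho> * cis t - (a - z0) \<noteq> 0" for t
    proof
      assume "of_real \<rho> * cis t - (a - z0) = 0"
      then have "cmod (of_real \<rho> * cis t) = cmod (a - z0)" by simp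
      then show False using a r \<rho> by (auto simp: annulus_def norm_mult)
    qed
    have i1: "(\<lambda>t. F (z0 + of_real \<rho> * cis t) * ?K \<rho> t) integrable_on {0..2*pi}"
      and i2: "(\<lambda>t. F a * (1 * ?K \<rho> t)) integrable_on {0..2*pi}"
      using ne by (auto intro!: integrable_continuous_interval continuous_intros continuous_on_circle[OF r \<rho> cont])
    have "h (z0 + of_real \<rho> * cis t) * (of_real \<rho> * cis t) =
        F (z0 + of_real \<rho> * cis t) * ?K \<rho> t - F a * (1 * ?K \<rho> t)" for t
    proof -
      have "z0 + of_real \<rho> * cis t \<noteq> a" using ne[of t] by (auto simp: algebra_simps)
      then show ?thesis by (simp add: h_def diff_divide_distrib algebra_simps)
    qed
    then show ?thesis
      using integral_diff[OF i1 i2] by (simp only: integral_mult_right)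
  qed
  with eq have "?I F r1 - F a * ?I (\<lambda>z. 1) r1 = ?I F r2 - F a * ?I (\<lambda>z. 1) r2" by simp
  then have "?I F r1 - ?I F r2 = F a * (?I (\<lambda>z. 1) r1 - ?I (\<lambda>z. 1) r2)" by (simp add: algebra_simps)
  then have "?I F r1 - ?I F r2 = 2 * of_real pi * F a" unfolding I1 by simp
  with moment_series[OF r F a] show ?thesis by simp
qed

section \<open>The reproducing kernel\<close>

lemma power_int_double:
  fixes x :: "'a :: field"
  assumes "x \<noteq> 0"
  shows "x powi (2 * n) = x powi n * x powi n"
  unfolding mult_2 using assms by (intro power_int_add) auto

text \<open>The powers \<open>(z - z0)\<^sup>n\<close> are orthogonal on the boundary, with squared norm
  \<open>2 \<pi> (r1\<^sup>2\<^sup>n\<^sup>+\<^sup>1 + r2\<^sup>2\<^sup>n\<^sup>+\<^sup>1)\<close>.\<close>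

definition szego_coeff :: "complex \<Rightarrow> real \<Rightarrow> real \<Rightarrow> complex \<Rightarrow> int \<Rightarrow> complex" where
  "szego_coeff z0 r1 r2 a n =
     cnj (a - z0) powi n / (2 * of_real pi * of_real (r1 powi (2*n+1) + r2 powi (2*n+1)))"

definition szego_series :: "complex \<Rightarrow> real \<Rightarrow> real \<Rightarrow> complex \<Rightarrow> complex \<Rightarrow> complex" where
  "szego_series z0 r1 r2 a z = (\<Sum>\<^sub>\<infinity>n. szego_coeff z0 r1 r2 a n * (z - z0) powi n)"

lemma annulus_ratio_bounds:
  assumes r: "0 < r2" "r2 < r1" and a: "a \<in> annulus z0 r1 r2" and z: "z \<in> closed_annulus z0 r1 r2"
  shows "(r2 / r1)\<^sup>2 < cmod ((z - z0) * cnj (a - z0) / of_real (r1\<^sup>2))"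
    and "cmod ((z - z0) * cnj (a - z0) / of_real (r1\<^sup>2)) < 1"
proof -
  have a': "r2 < cmod (a - z0)" "cmod (a - z0) < r1" using a by (auto simp: annulus_def)
  have z': "r2 \<le> cmod (z - z0)" "cmod (z - z0) \<le> r1" using z r by (auto simp: closed_annulus_eq)
  have e: "cmod ((z - z0) * cnj (a - z0) / of_real (r1\<^sup>2)) = cmod (z - z0) * cmod (a - z0) / r1\<^sup>2"
    by (simp add: norm_mult norm_divide norm_power flip: complex_cnj_diff)
  have "r2 * r2 < cmod (z - z0) * cmod (a - z0)"
    using a' z' r by (intro mult_le_less_imp_less) auto
  moreover have "cmod (z - z0) * cmod (a - z0) < r1 * r1"
    using a' z' r by (intro mult_le_less_imp_less) auto
  ultimately show "(r2 / r1)\<^sup>2 < cmod ((z - z0) * cnj (a - z0) / of_real (r1\<^sup>2))"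
    and "cmod ((z - z0) * cnj (a - z0) / of_real (r1\<^sup>2)) < 1"
    unfolding e using r by (simp_all add: power_divide divide_strict_right_mono power2_eq_square)
qed

text \<open>Dividing numerator and denominator of the \<open>n\<close>-th term by \<open>r1\<^sup>2\<^sup>n\<^sup>+\<^sup>1\<close> turns the series into
  Kronecker's series with \<open>p = (r2 / r1)\<^sup>2\<close> and \<open>b = - r2 / r1\<close>; the variable \<open>u\<close> satisfies
  \<open>p < |u| < 1\<close> even for \<open>z\<close> on the boundary.\<close>

lemma szego_has_sum:
  assumes r: "0 < r2" "r2 < r1" and a: "a \<in> annulus z0 r1 r2" and z: "z \<in> closed_annulus z0 r1 r2"
  defines "u \<equiv> (z - z0) * cnj (a - z0) / of_real (r1\<^sup>2)"
  shows "((\<lambda>n. szego_coeff z0 r1 r2 a n * (z - z0) powi n) has_sum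
     kronecker ((r2 / r1)\<^sup>2) u (- of_real (r2 / r1)) / (2 * of_real pi * of_real r1)) UNIV"
proof -
  let ?q = "r2 / r1"
  have q01: "0 < ?q" "?q < 1" and r1: "0 < r1" using r by auto
  note q = q01 square_bounds[OF q01]
  have u: "?q\<^sup>2 < cmod u" "cmod u < 1"
    unfolding u_def using annulus_ratio_bounds[OF r a z] by auto
  have "((\<lambda>n::int. u powi n / (1 - (- of_real ?q) * of_real (?q\<^sup>2) powi n)) has_sum
      kronecker (?q\<^sup>2) u (- of_real ?q)) UNIV"
    by (rule kronecker_has_sum[OF q(3,4) u]) (use q r r1 in \<open>simp_all add: norm_divide\<close>)
  from has_sum_divide_const[OF this, of "2 * of_real pi * of_real r1"]
  have "((\<lambda>n::int. u powi n / (1 - (- of_real ?q) * of_real (?q\<^sup>2) powi n) / (2 * of_real pi * of_real r1)) has_sum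
      kronecker (?q\<^sup>2) u (- of_real ?q) / (2 * of_real pi * of_real r1)) UNIV" .
  moreover have "u powi n / (1 - (- of_real ?q) * of_real (?q\<^sup>2) powi n) / (2 * of_real pi * of_real r1)
      = szego_coeff z0 r1 r2 a n * (z - z0) powi n" for n :: int
  proof -
    have d: "r1 powi (2*n+1) + r2 powi (2*n+1) = (r1 powi 2) powi n * r1 * (1 + ?q * (?q powi 2) powi n)"
    proof -
      have "(?q powi 2) powi n = (r2 powi 2) powi n / (r1 powi 2) powi n"
        by (simp only: power_int_divide_distrib)
      moreover have "s powi (2*n+1) = (s powi 2) powi n * s" if "s > 0" for s :: real
      proof -
        have "s powi (2*n+1) = s powi (2*n) * s" using that by (simp add: power_int_add)
        also have "s powi (2*n) = (s powi 2) powi n" by (rule power_int_mult)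
        finally show ?thesis .
      qed
      moreover have "(r1 powi 2) powi n > 0" using r1 by simp
      ultimately show ?thesis using r r1 by (simp add: distrib_left del: power_int_numeral)
    qed
    have u1: "u powi n = cnj (a - z0) powi n * (z - z0) powi n / of_real ((r1 powi 2) powi n)"
      by (simp add: u_def power_int_divide_distrib power_int_mult_distrib of_real_power_int)
    have d1: "1 - (- of_real ?q) * of_real (?q\<^sup>2) powi n = complex_of_real (1 + ?q * (?q powi 2) powi n)"
      by (simp add: of_real_power_int)
    have "(A * Z / W) / E / (P * x) = A / (P * (W * x * E)) * Z" for A Z W E P x :: complex
      by (simp add: divide_inverse mult_ac)
    from this[of "cnj (a - z0) powi n"] show ?thesis unfolding szego_coeff_def d u1 d1 of_real_mult .
  qed
  ultimately show ?thesis by simp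
qed

lemma szego_series_eq_kronecker:
  assumes "0 < r2" "r2 < r1" "a \<in> annulus z0 r1 r2" "z \<in> closed_annulus z0 r1 r2"
  shows "szego_series z0 r1 r2 a z =
    kronecker ((r2 / r1)\<^sup>2) ((z - z0) * cnj (a - z0) / of_real (r1\<^sup>2)) (- of_real (r2 / r1))
      / (2 * of_real pi * of_real r1)"
  unfolding szego_series_def by (rule infsumI[OF szego_has_sum[OF assms]])

lemma szego_coeff_summable:
  assumes r: "0 < r2" "r2 < r1" and a: "a \<in> annulus z0 r1 r2" and \<rho>: "\<rho> = r1 \<or> \<rho> = r2"
  shows "(\<lambda>n. szego_coeff z0 r1 r2 a n * of_real \<rho> powi n) summable_on UNIV"
  using has_sum_imp_summable[OF szego_has_sum[OF r a closed_annulus_polar[OF r \<rho>, of z0 0]]] by simp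

lemma szego_series_algebra:
  assumes r: "0 < r2" "r2 < r1" and a: "a \<in> annulus z0 r1 r2"
  shows "szego_series z0 r1 r2 a \<in> annulus_algebra z0 r1 r2"
proof -
  let ?f = "\<lambda>w. \<Sum>\<^sub>\<infinity>n. szego_coeff z0 r1 r2 a n * w powi n"
  have eq: "szego_series z0 r1 r2 a = ?f \<circ> (\<lambda>z. z - z0)"
    by (simp add: szego_series_def fun_eq_iff)
  note sums = szego_coeff_summable[OF r a disjI1[OF refl]] szego_coeff_summable[OF r a disjI2[OF refl]]
  have le: "r2 \<le> r1" using r by simp
  have "?f holomorphic_on (\<lambda>z. z - z0) ` annulus z0 r1 r2"
    by (rule holomorphic_on_subset[OF laurent_holomorphic_on[OF r(1) le sums]]) (auto simp: annulus_def)
  moreover have "continuous_on ((\<lambda>z. z - z0) ` closed_annulus z0 r1 r2) ?f"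
    by (rule continuous_on_subset[OF laurent_continuous_on[OF r(1) le sums]]) (auto simp: closed_annulus_eq[OF r(2)])
  ultimately have "?f \<circ> (\<lambda>z. z - z0) holomorphic_on annulus z0 r1 r2"
    "continuous_on (closed_annulus z0 r1 r2) (?f \<circ> (\<lambda>z. z - z0))"
    using holomorphic_on_compose[of "\<lambda>z. z - z0" "annulus z0 r1 r2" ?f]
      continuous_on_compose[of "closed_annulus z0 r1 r2" "\<lambda>z. z - z0" ?f]
    by (simp_all add: holomorphic_intros continuous_intros)
  then show ?thesis unfolding annulus_algebra_def eq by simp
qed

lemma szego_series_hermitian: "cnj (szego_series z0 r1 r2 a z) = szego_series z0 r1 r2 z a"
  unfolding szego_series_def infsum_cnj[symmetric]
  by (rule infsum_cong) (simp add: szego_coeff_def mult_ac)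

lemma LINT_continuous:
  fixes f :: "real \<Rightarrow> complex"
  assumes "continuous_on {a..b} f"
  shows "(LINT t|lebesgue_on {a..b}. f t) = integral {a..b} f"
  by (rule lebesgue_integral_eq_integral[OF continuous_imp_integrable_real[OF assms]]) simp

text \<open>Integrating termwise, the contribution of the circle of radius \<open>\<rho>\<close> is the Laurent series of \<open>F\<close> at
  \<open>a\<close> with its \<open>n\<close>-th term weighted by \<open>\<rho>\<^sup>2\<^sup>n\<^sup>+\<^sup>1 / (r1\<^sup>2\<^sup>n\<^sup>+\<^sup>1 + r2\<^sup>2\<^sup>n\<^sup>+\<^sup>1)\<close>. The moments are the
  same on both circles and the two weights add up to one.\<close>

lemma bdry_inner_szego_algebra:
  assumes r: "0 < r2" "r2 < r1" and F: "F \<in> annulus_algebra z0 r1 r2" and a: "a \<in> annulus z0 r1 r2"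
  shows "bdry_inner z0 r1 r2 F (szego_series z0 r1 r2 a) = F a"
proof -
  let ?S = "szego_series z0 r1 r2 a"
  define d where "d n = r1 powi (2*n+1) + r2 powi (2*n+1)" for n
  define T where "T n = (a - z0) powi n * circle_moment z0 r1 F n / (2 * of_real pi)" for n
  have contF: "continuous_on (closed_annulus z0 r1 r2) F" using F by (simp add: annulus_algebra_def)
  have contS: "continuous_on (closed_annulus z0 r1 r2) ?S"
    using szego_series_algebra[OF r a] by (simp add: annulus_algebra_def)
  have circle: "((\<lambda>n. T n * of_real (\<rho> powi (2*n+1) / d n)) has_sum
       circle_arc_integral z0 \<rho> (\<lambda>z. F z * cnj (?S z))) UNIV" if \<rho>: "\<rho> = r1 \<or> \<rho> = r2" for \<rho>
  proof -
    define c where "c n = cnj (szego_coeff z0 r1 r2 a n * of_real \<rho> powi n)" for n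
    have \<rho>0: "\<rho> \<noteq> 0" using \<rho> r by auto
    have c: "c summable_on UNIV" unfolding c_def
      by (rule summable_on_cnj_iff[THEN iffD2, OF szego_coeff_summable[OF r a \<rho>]])
    have "cnj (?S (z0 + of_real \<rho> * cis t)) = (\<Sum>\<^sub>\<infinity>n. c n * cis (- of_int n * t))" for t
      unfolding szego_series_def infsum_cnj[symmetric]
      by (rule infsum_cong) (simp add: c_def power_int_mult_distrib cis_power_int cis_cnj)
    moreover have "circle_arc_integral z0 \<rho> (\<lambda>z. F z * cnj (?S z)) = of_real \<rho> *
        integral {0..2*pi} (\<lambda>t. F (z0 + of_real \<rho> * cis t) * cnj (?S (z0 + of_real \<rho> * cis t)))"
      unfolding circle_arc_integral_def
      by (subst LINT_continuous)
        (auto intro!: continuous_intros continuous_on_circle[OF r \<rho> contF] continuous_on_circle[OF r \<rho> contS])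
    ultimately have e: "circle_arc_integral z0 \<rho> (\<lambda>z. F z * cnj (?S z)) = of_real \<rho> *
        integral {0..2*pi} (\<lambda>t. F (z0 + of_real \<rho> * cis t) * (\<Sum>\<^sub>\<infinity>n. c n * cis (- of_int n * t)))" by simp
    have "((\<lambda>n. of_real \<rho> * (c n * integral {0..2*pi} (\<lambda>t. F (z0 + of_real \<rho> * cis t) * cis (- of_int n * t))))
        has_sum circle_arc_integral z0 \<rho> (\<lambda>z. F z * cnj (?S z))) UNIV"
      unfolding e
      by (intro has_sum_cmult_right integral_series c)
        (auto intro!: continuous_intros continuous_on_circle[OF r \<rho> contF])
    moreover have "of_real \<rho> * (c n * integral {0..2*pi} (\<lambda>t. F (z0 + of_real \<rho> * cis t) * cis (- of_int n * t)))
        = T n * of_real (\<rho> powi (2*n+1) / d n)" for n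
    proof -
      let ?J = "integral {0..2*pi} (\<lambda>t. F (z0 + of_real \<rho> * cis t) * cis (- of_int n * t))"
      have m: "circle_moment z0 r1 F n = circle_moment z0 \<rho> F n"
        using \<rho> circle_moment_const[OF r F] by auto
      have "?J = of_real (\<rho> powi n) * circle_moment z0 r1 F n"
        unfolding m unfolding circle_moment_eq using \<rho>0 by (simp add: power_int_minus of_real_power_int)
      moreover have "c n = (a - z0) powi n * of_real (\<rho> powi n) / (2 * of_real pi * of_real (d n))"
      proof -
        have "cnj (szego_coeff z0 r1 r2 a n) = (a - z0) powi n / (2 * of_real pi * of_real (d n))"
          unfolding szego_coeff_def d_def[symmetric] by simp
        moreover have "cnj (of_real \<rho> powi n) = of_real (\<rho> powi n)" by (simp add: of_real_power_int)
        ultimately show ?thesis unfolding c_def complex_cnj_mult by (simp only: times_divide_eq_left)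
      qed
      moreover have "\<rho> powi (2*n+1) = \<rho> * \<rho> powi n * \<rho> powi n"
        using \<rho>0 by (simp add: power_int_add power_int_double)
      moreover have "x * (A * R / (P * D) * (R * M)) = A * M / P * (x * R * R / D)" for x A R P D M :: complex
        by (simp add: divide_inverse mult_ac)
      ultimately show ?thesis unfolding T_def by (simp only: of_real_mult of_real_divide)
    qed
    ultimately show ?thesis by simp
  qed
  have "T n * of_real (r1 powi (2*n+1) / d n) + T n * of_real (r2 powi (2*n+1) / d n) = T n" for n
  proof -
    have "d n > 0" using r by (simp add: d_def add_pos_pos)
    then have "r1 powi (2*n+1) / d n + r2 powi (2*n+1) / d n = 1"
      by (simp add: d_def flip: add_divide_distrib)
    then show ?thesis by (metis distrib_left of_real_add of_real_1 mult_1_right)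
  qed
  with has_sum_add[OF circle[of r1] circle[of r2]]
  have "(T has_sum bdry_inner z0 r1 r2 F ?S) UNIV" by (simp add: bdry_inner_def)
  moreover have "(T has_sum F a) UNIV"
    using has_sum_divide_const[OF annulus_algebra_laurent[OF r F a], of "2 * of_real pi"] by (simp add: T_def[abs_def])
  ultimately show ?thesis by (rule has_sum_unique)
qed

section \<open>Passage to the Hardy space\<close>

lemma finite_measure_circle: "finite_measure (lebesgue_on {0..2*pi})"
  by (intro finite_measure_lebesgue_on) auto

text \<open>A substitute for the Cauchy-Schwarz inequality: it rests on \<open>x \<le> e + x\<^sup>2 / e\<close>, which bounds an
  integral of \<open>|h|\<close> by one of \<open>|h|\<^sup>2\<close>; the parameter \<open>e\<close> is chosen small in the application.\<close>

lemma L2_times_bounded: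
  fixes h g :: "real \<Rightarrow> complex"
  defines "M \<equiv> lebesgue_on {0..2*pi}"
  assumes h: "h \<in> borel_measurable M" "integrable M (\<lambda>t. (cmod (h t))\<^sup>2)"
    and g: "continuous_on {0..2*pi} g" "\<And>t. t \<in> {0..2*pi} \<Longrightarrow> cmod (g t) \<le> B"
    and e: "e > 0"
  shows "integrable M (\<lambda>t. h t * cnj (g t))"
    and "cmod (LINT t|M. h t * cnj (g t)) \<le> B * (2 * pi * e + (LINT t|M. (cmod (h t))\<^sup>2) / e)"
proof -
  interpret finite_measure M unfolding M_def by (rule finite_measure_circle)
  have B: "0 \<le> B" using g(2)[of 0] norm_ge_zero[of "g 0"] by (simp del: norm_ge_zero) 
  have mg: "(\<lambda>t. cnj (g t)) \<in> borel_measurable M"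
    unfolding M_def by (rule continuous_imp_measurable_on_sets_lebesgue) (auto intro!: continuous_intros g)
  have le: "x \<le> e + x\<^sup>2 / e" if "x \<ge> 0" for x :: real
  proof (cases "x \<le> e")
    case True
    then show ?thesis using e by (smt (verit) divide_nonneg_pos zero_le_power2)
  next
    case False
    then have "x * e \<le> x * x" using that by (intro mult_left_mono) auto
    then have "x \<le> x\<^sup>2 / e" using e by (simp add: pos_le_divide_eq power2_eq_square)
    then show ?thesis using e by linarith
  qed
  have bound: "norm (h t * cnj (g t)) \<le> B * (e + (cmod (h t))\<^sup>2 / e)" if "t \<in> space M" for t
  proof -
    have "cmod (g t) * cmod (h t) \<le> B * (e + (cmod (h t))\<^sup>2 / e)"
      using g(2)[of t] that B le[of "cmod (h t)"] by (intro mult_mono) (auto simp: M_def)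
    then show ?thesis by (simp add: norm_mult mult.commute)
  qed
  have iD: "integrable M (\<lambda>t. B * (e + (cmod (h t))\<^sup>2 / e))" using h by simp
  show int: "integrable M (\<lambda>t. h t * cnj (g t))"
  proof (rule Bochner_Integration.integrable_bound[OF iD])
    show "(\<lambda>t. h t * cnj (g t)) \<in> borel_measurable M" using h mg by simp
    show "AE t in M. norm (h t * cnj (g t)) \<le> norm (B * (e + (cmod (h t))\<^sup>2 / e))"
      by (rule AE_I2) (use bound in \<open>fastforce simp: abs_le_iff intro: order_trans\<close>)
  qed
  have "cmod (LINT t|M. h t * cnj (g t)) \<le> (LINT t|M. norm (h t * cnj (g t)))"
    by (rule integral_norm_bound)
  also have "\<dots> \<le> (LINT t|M. B * (e + (cmod (h t))\<^sup>2 / e))"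
    by (rule integral_mono[OF integrable_norm[OF int] iD bound])
  also have "\<dots> = B * (2 * pi * e + (LINT t|M. (cmod (h t))\<^sup>2) / e)"
  proof -
    have "measure M (space M) = 2 * pi" by (simp add: M_def measure_restrict_space)
    then show ?thesis using h by simp
  qed
  finally show "cmod (LINT t|M. h t * cnj (g t)) \<le> B * (2 * pi * e + (LINT t|M. (cmod (h t))\<^sup>2) / e)" .
qed

lemma algebra_circle_L2:
  assumes "0 < r2" "r2 < r1" "\<rho> = r1 \<or> \<rho> = r2" "F \<in> annulus_algebra z0 r1 r2"
  shows "F \<in> circle_L2 z0 \<rho>"
proof -
  have c: "continuous_on {0..2*pi} (\<lambda>t. F (z0 + of_real \<rho> * cis t))"
    by (rule continuous_on_circle[OF assms(1-3)]) (use assms(4) in \<open>simp add: annulus_algebra_def\<close>)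
  then have "integrable (lebesgue_on {0..2*pi}) (\<lambda>t. (cmod (F (z0 + of_real \<rho> * cis t)))\<^sup>2)"
    by (intro continuous_imp_integrable_real continuous_intros)
  then show ?thesis unfolding circle_L2_def
    using continuous_imp_measurable_on_sets_lebesgue[OF c] by simp
qed

lemma circle_L2_diff:
  assumes "f \<in> circle_L2 z0 \<rho>" "g \<in> circle_L2 z0 \<rho>"
  shows "(\<lambda>z. f z - g z) \<in> circle_L2 z0 \<rho>"
proof -
  let ?M = "lebesgue_on {0..2*pi}"
  let ?f = "\<lambda>t. f (z0 + of_real \<rho> * cis t)" and ?g = "\<lambda>t. g (z0 + of_real \<rho> * cis t)"
  have m: "?f \<in> borel_measurable ?M" "?g \<in> borel_measurable ?M"
    and i: "integrable ?M (\<lambda>t. 2 * (cmod (?f t))\<^sup>2 + 2 * (cmod (?g t))\<^sup>2)"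
    using assms by (auto simp: circle_L2_def)
  have le: "(cmod (x - y))\<^sup>2 \<le> 2 * (cmod x)\<^sup>2 + 2 * (cmod y)\<^sup>2" for x y
  proof -
    have "(cmod (x - y))\<^sup>2 \<le> (cmod x + cmod y)\<^sup>2"
      by (intro power_mono norm_triangle_ineq4) auto
    also have "\<dots> \<le> 2 * (cmod x)\<^sup>2 + 2 * (cmod y)\<^sup>2"
      using zero_le_power2[of "cmod x - cmod y"] by (simp add: power2_eq_square algebra_simps)
    finally show ?thesis .
  qed
  have "integrable ?M (\<lambda>t. (cmod (?f t - ?g t))\<^sup>2)"
    by (rule Bochner_Integration.integrable_bound[OF i]) (use m le in auto)
  then show ?thesis using m by (auto simp: circle_L2_def)
qed

lemma bdry_inner_self:
  "bdry_inner z0 r1 r2 h h = of_real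
     (r1 * (LINT t|lebesgue_on {0..2*pi}. (cmod (h (z0 + of_real r1 * cis t)))\<^sup>2) +
      r2 * (LINT t|lebesgue_on {0..2*pi}. (cmod (h (z0 + of_real r2 * cis t)))\<^sup>2))"
  unfolding bdry_inner_def circle_arc_integral_def complex_norm_square[symmetric] integral_complex_of_real
  by simp

lemma bdry_inner_bound:
  assumes r: "0 < r2" "r2 < r1" and h: "h \<in> circle_L2 z0 r1" "h \<in> circle_L2 z0 r2"
    and g: "continuous_on (closed_annulus z0 r1 r2) g" "\<And>z. z \<in> closed_annulus z0 r1 r2 \<Longrightarrow> cmod (g z) \<le> B"
    and e: "e > 0"
  shows "cmod (bdry_inner z0 r1 r2 h g) \<le>
    B * (2 * pi * (r1 + r2) * e + Re (bdry_inner z0 r1 r2 h h) / e)"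
proof -
  have *: "cmod (circle_arc_integral z0 \<rho> (\<lambda>z. h z * cnj (g z))) \<le> \<rho> * (B * (2 * pi * e +
      (LINT t|lebesgue_on {0..2*pi}. (cmod (h (z0 + of_real \<rho> * cis t)))\<^sup>2) / e))" if \<rho>: "\<rho> = r1 \<or> \<rho> = r2" for \<rho>
  proof -
    have "h \<in> circle_L2 z0 \<rho>" using \<rho> h by auto
    then have "cmod (LINT t|lebesgue_on {0..2*pi}. h (z0 + of_real \<rho> * cis t) * cnj (g (z0 + of_real \<rho> * cis t)))
        \<le> B * (2 * pi * e + (LINT t|lebesgue_on {0..2*pi}. (cmod (h (z0 + of_real \<rho> * cis t)))\<^sup>2) / e)"
      by (intro L2_times_bounded(2) continuous_on_circle[OF r \<rho> g(1)] g(2) closed_annulus_polar[OF r \<rho>] e)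
        (auto simp: circle_L2_def)
    then show ?thesis unfolding circle_arc_integral_def norm_mult norm_of_real
      using \<rho> r by (auto intro!: mult_left_mono)
  qed
  have "cmod (bdry_inner z0 r1 r2 h g) \<le>
     cmod (circle_arc_integral z0 r1 (\<lambda>z. h z * cnj (g z))) + cmod (circle_arc_integral z0 r2 (\<lambda>z. h z * cnj (g z)))"
    unfolding bdry_inner_def by (rule norm_triangle_ineq)
  also note add_mono[OF *[of r1] *[of r2]]
  finally show ?thesis unfolding bdry_inner_self by (simp add: algebra_simps add_divide_distrib)
qed

lemma bdry_inner_diff:
  assumes r: "0 < r2" "r2 < r1" and "f \<in> circle_L2 z0 r1" "f \<in> circle_L2 z0 r2"
    and "h \<in> circle_L2 z0 r1" "h \<in> circle_L2 z0 r2"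
    and g: "continuous_on (closed_annulus z0 r1 r2) g"
  shows "bdry_inner z0 r1 r2 (\<lambda>z. f z - h z) g = bdry_inner z0 r1 r2 f g - bdry_inner z0 r1 r2 h g"
proof -
  have int: "integrable (lebesgue_on {0..2*pi}) (\<lambda>t. f (z0 + of_real \<rho> * cis t) * cnj (g (z0 + of_real \<rho> * cis t)))"
    if \<rho>: "\<rho> = r1 \<or> \<rho> = r2" and f: "f \<in> circle_L2 z0 \<rho>" for f \<rho>
  proof -
    have c: "continuous_on {0..2*pi} (\<lambda>t. g (z0 + of_real \<rho> * cis t))"
      by (rule continuous_on_circle[OF r \<rho> g])
    then obtain B where "\<forall>t\<in>{0..2*pi}. cmod (g (z0 + of_real \<rho> * cis t)) \<le> B"
      using compact_imp_bounded[OF compact_continuous_image[OF c compact_Icc]]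
      unfolding bounded_iff by auto
    then show ?thesis
      using f c by (intro L2_times_bounded(1)[where B = B and e = 1]) (auto simp: circle_L2_def)
  qed
  show ?thesis
    unfolding bdry_inner_def circle_arc_integral_def
    using int assms by (simp add: left_diff_distrib algebra_simps)
qed

lemma algebra_subset_hardy:
  assumes "0 < r2" "r2 < r1"
  shows "annulus_algebra z0 r1 r2 \<subseteq> hardy_space z0 r1 r2"
proof
  fix F assume F: "F \<in> annulus_algebra z0 r1 r2"
  then have "F \<in> circle_L2 z0 r1 \<inter> circle_L2 z0 r2"
    using algebra_circle_L2[OF assms] by auto
  with F show "F \<in> hardy_space z0 r1 r2"
    unfolding hardy_space_def
    by (auto simp: annulus_algebra_def bdry_inner_def circle_arc_integral_def intro!: exI[of _ "\<lambda>n. F"])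
qed

text \<open>Both sides of the reproducing identity pass to the limit: point evaluations by the definition of
  the Hardy space, and the inner product because the kernel is bounded on the closed annulus.\<close>

lemma bdry_inner_szego_hardy:
  assumes r: "0 < r2" "r2 < r1" and f: "f \<in> hardy_space z0 r1 r2" and a: "a \<in> annulus z0 r1 r2"
  shows "bdry_inner z0 r1 r2 f (szego_series z0 r1 r2 a) = f a"
proof -
  let ?S = "szego_series z0 r1 r2 a"
  obtain F where F: "\<And>n. F n \<in> annulus_algebra z0 r1 r2"
    and L2: "(\<lambda>n. bdry_inner z0 r1 r2 (\<lambda>z. F n z - f z) (\<lambda>z. F n z - f z)) \<longlonglongrightarrow> 0"
    and pt: "\<And>z. z \<in> annulus z0 r1 r2 \<Longrightarrow> (\<lambda>n. F n z) \<longlonglongrightarrow> f z"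
    using f unfolding hardy_space_def by blast
  define J where "J n = Re (bdry_inner z0 r1 r2 (\<lambda>z. F n z - f z) (\<lambda>z. F n z - f z))" for n
  have J0: "J \<longlonglongrightarrow> 0" unfolding J_def using tendsto_Re[OF L2] by simp
  have fL2: "f \<in> circle_L2 z0 r1" "f \<in> circle_L2 z0 r2" using f by (auto simp: hardy_space_def)
  have FL2: "F n \<in> circle_L2 z0 r1" "F n \<in> circle_L2 z0 r2" for n
    using algebra_circle_L2[OF r _ F] by auto
  have contS: "continuous_on (closed_annulus z0 r1 r2) ?S"
    using szego_series_algebra[OF r a] by (simp add: annulus_algebra_def)
  have "compact (closed_annulus z0 r1 r2)"
  proof -
    have "closed_annulus z0 r1 r2 = cball z0 r1 - ball z0 r2"
      unfolding closed_annulus_eq[OF r(2)] by (auto simp: dist_norm norm_minus_commute)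
    then show ?thesis by (simp add: compact_diff)
  qed
  from compact_imp_bounded[OF compact_continuous_image[OF contS this]]
  obtain B where B: "B > 0" "\<And>z. z \<in> closed_annulus z0 r1 r2 \<Longrightarrow> cmod (?S z) \<le> B"
    unfolding bounded_pos by auto
  have diff: "F n a - bdry_inner z0 r1 r2 f ?S = bdry_inner z0 r1 r2 (\<lambda>z. F n z - f z) ?S" for n
    using bdry_inner_diff[OF r FL2 fL2 contS] bdry_inner_szego_algebra[OF r F a] by simp
  have "(\<lambda>n. F n a) \<longlonglongrightarrow> bdry_inner z0 r1 r2 f ?S"
  proof (rule LIMSEQ_I)
    fix \<epsilon> :: real assume \<epsilon>: "0 < \<epsilon>"
    \<comment> \<open>This choice makes the part of \<open>bdry_inner_bound\<close> that does not involve \<open>J\<close> equal to \<open>\<epsilon> / 2\<close>.\<close>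
    define e where "e = \<epsilon> / (2 * B * (2 * pi * (r1 + r2)))"
    have pos: "0 < 2 * pi * (r1 + r2)" using r by simp
    have e: "0 < e" unfolding e_def using \<epsilon> B(1) r pos by (intro divide_pos_pos mult_pos_pos) auto
    have e2: "B * (2 * pi * (r1 + r2) * e) = \<epsilon> / 2"
    proof -
      have "B * (K * (\<epsilon> / (2 * B * K))) = \<epsilon> / 2" if "K > 0" for K
        using that B(1) by (simp add: field_simps)
      from this[OF pos] show ?thesis unfolding e_def .
    qed
    have "0 < \<epsilon> * e / (2 * B)" using \<epsilon> e B by simp
    from LIMSEQ_D[OF J0 this] obtain N where N: "\<And>n. n \<ge> N \<Longrightarrow> \<bar>J n\<bar> < \<epsilon> * e / (2 * B)" by auto
    have "norm (F n a - bdry_inner z0 r1 r2 f ?S) < \<epsilon>" if "n \<ge> N" for n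
    proof -
      have "cmod (F n a - bdry_inner z0 r1 r2 f ?S) \<le> B * (2 * pi * (r1 + r2) * e + J n / e)"
        unfolding diff J_def by (rule bdry_inner_bound[OF r _ _ contS B(2) e])
          (auto intro!: circle_L2_diff FL2 fL2)
      also have "\<dots> = \<epsilon> / 2 + B * (J n / e)" unfolding e2[symmetric] by (simp add: distrib_left)
      also have "B * (J n / e) < \<epsilon> / 2"
        using N[OF that] B(1) e by (simp add: field_simps abs_less_iff)
      finally show ?thesis by simp
    qed
    then show "\<exists>N. \<forall>n\<ge>N. norm (F n a - bdry_inner z0 r1 r2 f ?S) < \<epsilon>" by blast
  qed
  with pt[OF a] show ?thesis using LIMSEQ_unique by blast
qed

lemma is_szego_szego_series:
  assumes r: "0 < r2" "r2 < r1" and a: "a \<in> annulus z0 r1 r2"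
  shows "is_szego_at z0 r1 r2 a (szego_series z0 r1 r2 a)"
  using szego_series_algebra[OF r a] algebra_subset_hardy[OF r] bdry_inner_szego_hardy[OF r _ a]
  unfolding is_szego_at_def by (auto simp: annulus_algebra_def)

lemma bdry_inner_hermitian: "cnj (bdry_inner z0 r1 r2 f g) = bdry_inner z0 r1 r2 g f"
  by (simp add: bdry_inner_def circle_arc_integral_def mult.commute flip: Bochner_Integration.integral_cnj)

text \<open>Two reproducing kernels \<open>k\<close> and \<open>S\<close> reproduce each other: inside the annulus
  \<open>k(w) = \<langle>k, S\<^sub>w\<rangle>\<close> is the conjugate of \<open>\<langle>S\<^sub>w, k\<rangle> = S\<^sub>w(a)\<close>. By continuity, approaching a boundary point
  along its radius, they agree on the closed annulus.\<close>

lemma is_szego_at_unique: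
  assumes r: "0 < r2" "r2 < r1" and a: "a \<in> annulus z0 r1 r2" and k: "is_szego_at z0 r1 r2 a k"
    and z: "z \<in> closed_annulus z0 r1 r2"
  shows "k z = szego_series z0 r1 r2 a z"
proof -
  let ?S = "szego_series z0 r1 r2"
  have inside: "k w = ?S a w" if w: "w \<in> annulus z0 r1 r2" for w
  proof -
    have "k w = bdry_inner z0 r1 r2 k (?S w)"
      using bdry_inner_szego_hardy[OF r _ w] k by (simp add: is_szego_at_def)
    also have "\<dots> = cnj (bdry_inner z0 r1 r2 (?S w) k)" by (simp add: bdry_inner_hermitian)
    also have "bdry_inner z0 r1 r2 (?S w) k = ?S w a"
    proof -
      have "?S w \<in> hardy_space z0 r1 r2"
        using szego_series_algebra[OF r w] algebra_subset_hardy[OF r] by blast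
      then show ?thesis using k unfolding is_szego_at_def by metis
    qed
    finally show ?thesis by (simp add: szego_series_hermitian)
  qed
  define d where "d = (z - z0) / of_real (cmod (z - z0))"
  have z': "r2 \<le> cmod (z - z0)" "cmod (z - z0) \<le> r1" using z r by (auto simp: closed_annulus_eq)
  then have nz: "z \<noteq> z0" using r by auto
  have d: "cmod d = 1" using nz by (simp add: d_def norm_divide)
  define g where "g s = k (z0 + of_real s * d) - ?S a (z0 + of_real s * d)" for s
  have ray: "z0 + of_real s * d \<in> closed_annulus z0 r1 r2" if "s \<in> {r2..r1}" for s
    using that d r by (auto simp: closed_annulus_eq norm_mult)
  have contS: "continuous_on (closed_annulus z0 r1 r2) (\<lambda>z. k z - ?S a z)"
    using k szego_series_algebra[OF r a] by (auto simp: is_szego_at_def annulus_algebra_def intro!: continuous_intros)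
  have cl: "closure {r2<..<r1} = {r2..r1}" using r by simp
  have "g (cmod (z - z0)) = 0"
  proof (rule continuous_constant_on_closure[of "{r2<..<r1}" g])
    show "continuous_on (closure {r2<..<r1}) g"
      unfolding cl g_def
      by (rule continuous_on_compose2[OF contS]) (auto intro!: continuous_intros ray)
    show "g s = 0" if "s \<in> {r2<..<r1}" for s
      using inside[of "z0 + of_real s * d"] that d r by (auto simp: g_def annulus_def norm_mult)
    show "cmod (z - z0) \<in> closure {r2<..<r1}" unfolding cl using z' by simp
  qed
  moreover have "z0 + of_real (cmod (z - z0)) * d = z" using nz by (simp add: d_def)
  ultimately show ?thesis by (simp add: g_def)
qed

lemma szego_kernel_eq_series:
  assumes "0 < r2" "r2 < r1" "a \<in> annulus z0 r1 r2" "z \<in> closed_annulus z0 r1 r2"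
  shows "szego_kernel z0 r1 r2 z a = szego_series z0 r1 r2 a z"
  unfolding szego_kernel_def
  by (rule is_szego_at_unique[OF assms(1-3) someI[of "is_szego_at z0 r1 r2 a", OF is_szego_szego_series[OF assms(1-3)]] assms(4)])

section \<open>The two series and the zero of the Szego kernel\<close>

lemma szego_kernel_eq_0_iff:
  assumes r: "0 < r2" "r2 < r1" and a: "a \<in> annulus z0 r1 r2" and z: "z \<in> closed_annulus z0 r1 r2"
  shows "szego_kernel z0 r1 r2 z a = 0 \<longleftrightarrow> z = z0 - of_real (r1 * r2) / cnj (a - z0)"
proof -
  define u where "u = (z - z0) * cnj (a - z0) / of_real (r1\<^sup>2)"
  let ?q = "r2 / r1"
  have q: "0 < ?q" "?q < 1" and r1: "r1 > 0" using r by auto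
  have an: "cnj (a - z0) \<noteq> 0" "cnj a \<noteq> cnj z0" using a r by (auto simp: annulus_def)
  have "szego_kernel z0 r1 r2 z a = 0 \<longleftrightarrow> kronecker (?q\<^sup>2) u (- of_real ?q) = 0"
    unfolding szego_kernel_eq_series[OF assms] szego_series_eq_kronecker[OF assms] u_def using r1 by simp
  also have "\<dots> \<longleftrightarrow> u = - of_real ?q"
    by (rule kronecker_theta_zero[OF q annulus_ratio_bounds[OF assms, folded u_def]])
  also have "\<dots> \<longleftrightarrow> (z - z0) * cnj (a - z0) = - of_real (r1 * r2)"
    using r1 by (simp add: u_def divide_simps power2_eq_square) (metis mult.commute)
  also have "\<dots> \<longleftrightarrow> z = z0 - of_real (r1 * r2) / cnj (a - z0)"
    using an by (auto simp: field_simps)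
  finally show ?thesis .
qed

text \<open>The symmetry of Kronecker's function exchanges the roles of \<open>u\<close> and \<open>b = - q\<close>; the index is then
  reversed.\<close>

lemma kronecker_theta_second_series:
  assumes q: "0 < q" "q < 1" and u: "q\<^sup>2 < cmod u" "cmod u < 1"
  shows "((\<lambda>n::int. (- 1) powi n * of_real (q powi n) / (of_real ((q\<^sup>2) powi n) - u))
      has_sum kronecker (q\<^sup>2) u (- of_real q)) UNIV"
proof -
  note p = square_bounds[OF q]
  have "((\<lambda>n::int. (- of_real q) powi n / (1 - u * of_real (q\<^sup>2) powi n))
      has_sum kronecker (q\<^sup>2) (- of_real q) u) UNIV"
    by (rule kronecker_has_sum[OF p(1,2) _ _ u]) (simp_all add: q p(3) abs_of_pos)
  then have "((\<lambda>n::int. (- of_real q) powi (- n) / (1 - u * of_real (q\<^sup>2) powi (- n)))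
      has_sum kronecker (q\<^sup>2) (- of_real q) u) UNIV"
    by (subst has_sum_reindex_bij_witness[of _ uminus uminus]) auto
  moreover have "(- of_real q) powi (- n) / (1 - u * of_real (q\<^sup>2) powi (- n)) =
      (- 1) powi n * of_real (q powi n) / (of_real ((q\<^sup>2) powi n) - u)" for n :: int
  proof -
    let ?x = "of_real (q powi n) :: complex"
    have x: "?x \<noteq> 0" using q by simp
    have 1: "(- of_real q) powi (- n) = (- 1) powi n / ?x"
    proof -
      have "(- complex_of_real q) = (- 1) * of_real q" by simp
      then have "(- complex_of_real q) powi (- n) = (- 1) powi (- n) * of_real q powi (- n)"
        by (metis power_int_mult_distrib)
      also have "(- 1 :: complex) powi (- n) = (- 1) powi n"
        by (cases "even n") auto
      finally show ?thesis by (simp add: power_int_minus of_real_power_int divide_inverse)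
    qed
    have 2: "of_real ((q\<^sup>2) powi n) = ?x * ?x"
      by (simp add: power2_eq_square power_int_mult_distrib of_real_power_int)
    have 3: "of_real (q\<^sup>2) powi (- n) = 1 / (?x * ?x)"
      using 2 by (simp add: power_int_minus of_real_power_int divide_inverse)
    have "1 - u * of_real (q\<^sup>2) powi (- n) \<noteq> 0"
      by (rule kronecker_denom_nonzero[OF p(1,2) u])
    then have "?x * ?x - u \<noteq> 0" unfolding 3 using x by auto
    moreover have "A / y / (1 - u * (1 / (y * y))) = A * y / (y * y - u)"
      if "y \<noteq> 0" "y * y - u \<noteq> 0" for A y
      using that by (simp add: divide_simps)
    ultimately show ?thesis unfolding 1 2 3 using x by blast
  qed
  ultimately show ?thesis by (simp add: kronecker_commute)
qed

theorem theorem2: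
  fixes z0 :: complex and r1 r2 :: real
  assumes "0 < r2" and "r2 < r1"
  shows "(\<forall>a\<in>annulus z0 r1 r2. \<forall>z\<in>annulus z0 r1 r2 \<union> annulus_bdry z0 r1 r2.
      (\<lambda>n::int. (cnj a - cnj z0) powi n / of_real (r1 powi (2*n+1) + r2 powi (2*n+1))
                 * (z - z0) powi n) summable_on UNIV \<and>
      szego_kernel z0 r1 r2 z a = 1 / (2 * of_real pi) *
        (\<Sum>\<^sub>\<infinity>n::int. (cnj a - cnj z0) powi n / of_real (r1 powi (2*n+1) + r2 powi (2*n+1))
                 * (z - z0) powi n) \<and>
      (\<lambda>n::int. (- 1) powi n * of_real (r1 powi (n+1) * r2 powi n) /
                 (of_real (r2 powi (2*n) * r1\<^sup>2)
                  - of_real (r1 powi (2*n)) * (z - z0) * (cnj a - cnj z0))) summable_on UNIV \<and>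
      szego_kernel z0 r1 r2 z a = 1 / (2 * of_real pi) *
        (\<Sum>\<^sub>\<infinity>n::int. (- 1) powi n * of_real (r1 powi (n+1) * r2 powi n) /
                 (of_real (r2 powi (2*n) * r1\<^sup>2)
                  - of_real (r1 powi (2*n)) * (z - z0) * (cnj a - cnj z0))))
    \<and> (\<forall>a\<in>annulus z0 r1 r2.
         {z \<in> annulus z0 r1 r2. szego_kernel z0 r1 r2 z a = 0}
           = {z0 - of_real (r1 * r2) / (cnj a - cnj z0)})"
proof -
  note r = assms
  let ?q = "r2 / r1"
  have q: "0 < ?q" "?q < 1" and r1: "r1 > 0" using r by auto
  have series: "((\<lambda>n::int. (cnj a - cnj z0) powi n / of_real (r1 powi (2*n+1) + r2 powi (2*n+1))
                 * (z - z0) powi n) has_sum 2 * of_real pi * szego_kernel z0 r1 r2 z a) UNIV"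
    "((\<lambda>n::int. (- 1) powi n * of_real (r1 powi (n+1) * r2 powi n) /
                 (of_real (r2 powi (2*n) * r1\<^sup>2)
                  - of_real (r1 powi (2*n)) * (z - z0) * (cnj a - cnj z0)))
        has_sum 2 * of_real pi * szego_kernel z0 r1 r2 z a) UNIV"
    if a: "a \<in> annulus z0 r1 r2" and z: "z \<in> closed_annulus z0 r1 r2" for a z
  proof -
    define u where "u = (z - z0) * cnj (a - z0) / of_real (r1\<^sup>2)"
    have u: "?q\<^sup>2 < cmod u" "cmod u < 1" unfolding u_def using annulus_ratio_bounds[OF r a z] by auto
    have K: "2 * of_real pi * szego_kernel z0 r1 r2 z a = kronecker (?q\<^sup>2) u (- of_real ?q) / of_real r1"
      unfolding szego_kernel_eq_series[OF r a z] szego_series_eq_kronecker[OF r a z] u_def by simp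
    have "((\<lambda>n. 2 * of_real pi * (szego_coeff z0 r1 r2 a n * (z - z0) powi n)) has_sum
        2 * of_real pi * szego_kernel z0 r1 r2 z a) UNIV"
      unfolding szego_kernel_eq_series[OF r a z] szego_series_eq_kronecker[OF r a z]
      by (rule has_sum_cmult_right[OF szego_has_sum[OF r a z]])
    then show "((\<lambda>n::int. (cnj a - cnj z0) powi n / of_real (r1 powi (2*n+1) + r2 powi (2*n+1))
                 * (z - z0) powi n) has_sum 2 * of_real pi * szego_kernel z0 r1 r2 z a) UNIV"
      by (simp add: szego_coeff_def)
    have "(- 1) powi n * of_real (?q powi n) / (of_real ((?q\<^sup>2) powi n) - u) / of_real r1 =
       (- 1) powi n * of_real (r1 powi (n+1) * r2 powi n) /
                 (of_real (r2 powi (2*n) * r1\<^sup>2)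
                  - of_real (r1 powi (2*n)) * (z - z0) * (cnj a - cnj z0))" for n :: int
    proof -
      let ?D = "complex_of_real (r1 powi (2*n) * r1\<^sup>2)"
      have D: "?D \<noteq> 0" using r1 by simp
      have 1: "of_real (r1 powi (n+1) * r2 powi n) = ?D * (of_real (?q powi n) / of_real r1)"
      proof -
        have "r1 powi (2*n) = r1 powi n * r1 powi n" using r1 by (simp add: power_int_double)
        then have "r1 powi (n+1) * r2 powi n = r1 powi (2*n) * r1\<^sup>2 * (?q powi n / r1)"
          using r1 by (simp add: power_int_add power_int_divide_distrib power2_eq_square)
        then show ?thesis by (metis of_real_mult of_real_divide)
      qed
      have 2: "of_real (r2 powi (2*n) * r1\<^sup>2) - of_real (r1 powi (2*n)) * (z - z0) * (cnj a - cnj z0)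
          = ?D * (of_real ((?q\<^sup>2) powi n) - u)"
      proof -
        have "r2 powi (2*n) * r1\<^sup>2 = r1 powi (2*n) * r1\<^sup>2 * (?q\<^sup>2) powi n"
          using r1 by (simp add: power_int_mult power_divide power_int_divide_distrib)
        then have "complex_of_real (r2 powi (2*n) * r1\<^sup>2) = ?D * of_real ((?q\<^sup>2) powi n)"
          by (metis of_real_mult)
        moreover have "of_real (r1 powi (2*n)) * (z - z0) * (cnj a - cnj z0) = ?D * u"
          using r1 by (simp add: u_def)
        ultimately show ?thesis by (simp only: right_diff_distrib)
      qed
      have "(- 1) powi n * (?D * (of_real (?q powi n) / of_real r1)) / (?D * (of_real ((?q\<^sup>2) powi n) - u))
         = (?D * ((- 1) powi n * (of_real (?q powi n) / of_real r1))) / (?D * (of_real ((?q\<^sup>2) powi n) - u))"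
        by (simp only: mult.left_commute)
      also have "\<dots> = ((- 1) powi n * (of_real (?q powi n) / of_real r1)) / (of_real ((?q\<^sup>2) powi n) - u)"
        using D by (rule mult_divide_mult_cancel_left)
      finally show ?thesis unfolding 1 2 by (simp add: mult.commute)
    qed
    with has_sum_divide_const[OF kronecker_theta_second_series[OF q u], of "of_real r1"]
    show "((\<lambda>n::int. (- 1) powi n * of_real (r1 powi (n+1) * r2 powi n) /
                 (of_real (r2 powi (2*n) * r1\<^sup>2)
                  - of_real (r1 powi (2*n)) * (z - z0) * (cnj a - cnj z0)))
        has_sum 2 * of_real pi * szego_kernel z0 r1 r2 z a) UNIV"
      unfolding K by simp
  qed
  have zeros: "{z \<in> annulus z0 r1 r2. szego_kernel z0 r1 r2 z a = 0}
           = {z0 - of_real (r1 * r2) / (cnj a - cnj z0)}" if a: "a \<in> annulus z0 r1 r2" for a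
  proof -
    have a': "r2 < cmod (a - z0)" "cmod (a - z0) < r1" "0 < cmod (a - z0)" using a r by (auto simp: annulus_def)
    have "cmod (of_real (r1 * r2) / cnj (a - z0)) = r1 * r2 / cmod (a - z0)"
      using r r1 by (simp add: norm_divide norm_mult flip: complex_cnj_diff)
    moreover have "r2 < r1 * r2 / cmod (a - z0)" "r1 * r2 / cmod (a - z0) < r1"
      using a' r r1 by (simp_all add: pos_less_divide_eq pos_divide_less_eq)
    ultimately have "z0 - of_real (r1 * r2) / cnj (a - z0) \<in> annulus z0 r1 r2"
      by (simp add: annulus_def)
    then show ?thesis using szego_kernel_eq_0_iff[OF r a] by auto
  qed
  show ?thesis
  proof (intro conjI ballI)
    fix a z
    assume "a \<in> annulus z0 r1 r2" and "z \<in> closed_annulus z0 r1 r2"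
    note s = series[OF this]
    have scale: "K = 1 / (2 * of_real pi) * infsum f UNIV"
      if "(f has_sum 2 * of_real pi * K) UNIV" for f :: "int \<Rightarrow> complex" and K
      using infsumI[OF that] by simp
    show "(\<lambda>n::int. (cnj a - cnj z0) powi n / of_real (r1 powi (2*n+1) + r2 powi (2*n+1))
                 * (z - z0) powi n) summable_on UNIV"
      by (rule has_sum_imp_summable[OF s(1)])
    show "szego_kernel z0 r1 r2 z a = 1 / (2 * of_real pi) *
        (\<Sum>\<^sub>\<infinity>n::int. (cnj a - cnj z0) powi n / of_real (r1 powi (2*n+1) + r2 powi (2*n+1))
                 * (z - z0) powi n)"
      by (rule scale[OF s(1)])
    show "(\<lambda>n::int. (- 1) powi n * of_real (r1 powi (n+1) * r2 powi n) /
                 (of_real (r2 powi (2*n) * r1\<^sup>2)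
                  - of_real (r1 powi (2*n)) * (z - z0) * (cnj a - cnj z0))) summable_on UNIV"
      by (rule has_sum_imp_summable[OF s(2)])
    show "szego_kernel z0 r1 r2 z a = 1 / (2 * of_real pi) *
        (\<Sum>\<^sub>\<infinity>n::int. (- 1) powi n * of_real (r1 powi (n+1) * r2 powi n) /
                 (of_real (r2 powi (2*n) * r1\<^sup>2)
                  - of_real (r1 powi (2*n)) * (z - z0) * (cnj a - cnj z0)))"
      by (rule scale[OF s(2)])
  qed (rule zeros)
qed

end
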